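(* Let $Z$ and $W$ be scalar and each uniformly distributed on $[0,1]$, let $p\ge0$, $s\ge0$, $\rho,\tau>0$, $d\ge1$, $a>0$, and suppose that the conditional expectation operator $T$ associated with $(Z,W)$ belongs to $\mathcal T_\upsilon^d$ (with respect to the trigonometric basis $\{e_j\}$). If $\sigma>0$ is sufficiently large (with a threshold not depending on $n$), then for any estimator $\breve\ell$ based on an i.i.d. $n$-sample of $(Y,Z,W)$ with $Y=\varphi(Z)+U$: (i) in the polynomial case, i.e. $\upsilon_1=1$ and $\upsilon_j=|j|^{-2a}$, $j\ge2$, $$\sup_{U\in\mathcal U_\sigma}\sup_{\varphi\in\mathcal W_p^\rho}\sup_{h\in\mathcal W_s^\tau}\mathbb E|\breve\ell-\ell_h(\varphi)|^2\gtrsim\max\bigl(n^{-(p+s)/(p+a)},n^{-1}\bigr);$$ (ii) in the exponential case, i.e. $\upsilon_1=1$ and $\upsilon_j=\exp(-|j|^{2a})$, $j\ge2$, $$\sup_{U\in\mathcal U_\sigma}\sup_{\varphi\in\mathcal W_p^\rho}\sup_{h\in\mathcal W_s^\tau}\mathbb E|\breve\ell-\ell_h(\varphi)|^2\gtrsim(\log n)^{-(p+s)/a}.$$ Here $a_n\gtrsim b_n$ means that there is $c>0$ with $a_n\ge c\,b_n$ for all sufficiently large $n\in\mathbb N$.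
   Context: Model: $Y=\varphi(Z)+U$ with $\mathbb E[U\mid W]=0$. Since $Z,W$ are uniform on $[0,1]$, $L^2_Z=L^2_W=L^2[0,1]$ with the usual norm $\|\cdot\|$ and inner product $\langle\cdot,\cdot\rangle$. $T:L^2[0,1]\to L^2[0,1]$, $T\phi=\mathbb E[\phi(Z)\mid W=\cdot]$. $\ell_h(\varphi):=\mathbb E[h(Z)\varphi(Z)]=\langle h,\varphi\rangle$. Trigonometric basis: $e_1\equiv1$, $e_{2j}(t)=\sqrt2\cos(2\pi jt)$, $e_{2j+1}(t)=\sqrt2\sin(2\pi jt)$, $t\in[0,1]$, $j\in\mathbb N$. Sobolev ellipsoid: for $r\ge0$, $c>0$, $\mathcal W_r^c:=\{f\in L^2[0,1]:\ \sum_{j\ge1}w_j^r|\langle f,e_j\rangle|^2\le c\}$ with $w_1=1$, $w_j=|j|^2$ for $j\ge2$ (for $r=0$ this is a ball in $L^2[0,1]$). $\|\phi\|_\upsilon^2:=\sum_{j\ge1}\upsilon_j|\langle\phi,e_j\rangle|^2$; $\mathcal T_\upsilon^d$ is the set of injective compact operators $T$ with $\|\phi\|_\upsilon^2/d\le\|T\phi\|^2\le d\|\phi\|_\upsilon^2$ for all $\phi\in L^2[0,1]$. $\mathcal U_\sigma:=\{U:\ \mathbb E[U\mid W]=0,\ \mathbb E[U^4\mid W]\le\sigma^4\}$. The law of $(Z,W)$ is fixed, and $U$ ranges over all error terms jointly distributed with $(Z,W)$ (on a possibly enlarged probability space) satisfying these constraints. An estimator is a measurable function of the sample $(Y_i,Z_i,W_i)_{i=1}^n$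 (it may depend on the known representer $h$). *)

theory Defs
  imports "HOL-Probability.Probability"
begin

section \<open>The space of square integrable functions on the unit interval\<close>

text \<open>
  Elements of L2[0,1] are represented by Borel functions on the real line; their values outside
  [0,1] and on null sets are immaterial, since every notion below only sees them through
  \<^term>\<open>uniform_measure lborel {0..1::real}\<close> or at random points with that law.
\<close>

abbreviation unit_unif :: "real measure" where
  "unit_unif \<equiv> uniform_measure lborel {0..1}"

definition L2_unit :: "(real \<Rightarrow> real) set" where
  "L2_unit = {f \<in> borel_measurable borel. integrable unit_unif (\<lambda>t. (f t)\<^sup>2)}"

definition l2_inner :: "(real \<Rightarrow> real) \<Rightarrow> (real \<Rightarrow> real) \<Rightarrow> real" where
  "l2_inner f g = (LINT t|unit_unif. f t * g t)"

definition l2_norm :: "(real \<Rightarrow> real) \<Rightarrow> real" where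
  "l2_norm f = sqrt (l2_inner f f)"

section \<open>Trigonometric basis, Sobolev ellipsoids and weighted norms\<close>

text \<open>
  All sequences are indexed by \<open>j \<ge> 1\<close> as usual; the values at \<open>0\<close> are never used, and
  series over \<open>j \<ge> 1\<close> are written with the index \<open>Suc j\<close>. The series have nonnegative terms
  and are taken in \<^typ>\<open>ennreal\<close>, so that they may diverge to infinity.
\<close>

definition trig_basis :: "nat \<Rightarrow> real \<Rightarrow> real" where
  "trig_basis k t =
     (if k = 1 then 1
      else if even k then sqrt 2 * cos (2 * pi * real (k div 2) * t)
      else sqrt 2 * sin (2 * pi * real (k div 2) * t))"

definition weighted_sq_norm :: "(nat \<Rightarrow> real) \<Rightarrow> (real \<Rightarrow> real) \<Rightarrow> ennreal" where
  "weighted_sq_norm v f = (\<Sum>j. ennreal (v (Suc j) * (l2_inner f (trig_basis (Suc j)))\<^sup>2))"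

definition sobolev_weight :: "nat \<Rightarrow> real" where
  "sobolev_weight j = (if j = 1 then 1 else (real j)\<^sup>2)"

definition sobolev_ellipsoid :: "real \<Rightarrow> real \<Rightarrow> (real \<Rightarrow> real) set" where
  "sobolev_ellipsoid r c =
     {f \<in> L2_unit. weighted_sq_norm (\<lambda>j. sobolev_weight j powr r) f \<le> ennreal c}"

definition poly_weight :: "real \<Rightarrow> nat \<Rightarrow> real" where
  "poly_weight a j = (if j = 1 then 1 else real j powr (-2 * a))"

definition exp_weight :: "real \<Rightarrow> nat \<Rightarrow> real" where
  "exp_weight a j = (if j = 1 then 1 else exp (- (real j powr (2 * a))))"

section \<open>Operators and the link condition\<close>

text \<open>
  Linearity and injectivity are understood modulo equality almost everywhere. A compact
  operator sends every sequence in the unit ball to one with a norm convergent subsequence.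
\<close>

definition linear_L2_operator :: "((real \<Rightarrow> real) \<Rightarrow> real \<Rightarrow> real) \<Rightarrow> bool" where
  "linear_L2_operator T \<longleftrightarrow>
     (\<forall>f\<in>L2_unit. T f \<in> L2_unit) \<and>
     (\<forall>f\<in>L2_unit. \<forall>g\<in>L2_unit. \<forall>a b.
        AE t in unit_unif. T (\<lambda>x. a * f x + b * g x) t = a * T f t + b * T g t)"

definition injective_L2_operator :: "((real \<Rightarrow> real) \<Rightarrow> real \<Rightarrow> real) \<Rightarrow> bool" where
  "injective_L2_operator T \<longleftrightarrow>
     (\<forall>f\<in>L2_unit. (AE t in unit_unif. T f t = 0) \<longrightarrow> (AE t in unit_unif. f t = 0))"

definition compact_L2_operator :: "((real \<Rightarrow> real) \<Rightarrow> real \<Rightarrow> real) \<Rightarrow> bool" where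
  "compact_L2_operator T \<longleftrightarrow>
     (\<forall>f :: nat \<Rightarrow> real \<Rightarrow> real. (\<forall>k. f k \<in> L2_unit \<and> l2_norm (f k) \<le> 1) \<longrightarrow>
        (\<exists>r g. strict_mono r \<and> g \<in> L2_unit \<and>
           (\<lambda>k. l2_norm (\<lambda>t. T (f (r k)) t - g t)) \<longlonglongrightarrow> 0))"

definition link_class :: "(nat \<Rightarrow> real) \<Rightarrow> real \<Rightarrow> ((real \<Rightarrow> real) \<Rightarrow> real \<Rightarrow> real) set" where
  "link_class v d =
     {T. linear_L2_operator T \<and> injective_L2_operator T \<and> compact_L2_operator T \<and>
         (\<forall>f\<in>L2_unit.
            weighted_sq_norm v f / ennreal d \<le> ennreal ((l2_norm (T f))\<^sup>2) \<and>
            ennreal ((l2_norm (T f))\<^sup>2) \<le> ennreal d * weighted_sq_norm v f)}"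

section \<open>The conditional expectation operator\<close>

abbreviation sigma_gen :: "'m measure \<Rightarrow> ('m \<Rightarrow> real) \<Rightarrow> 'm measure" where
  "sigma_gen M W \<equiv> vimage_algebra (space M) W borel"

text \<open>
  \<open>cond_exp_op M Z W \<phi>\<close> is a Borel version of \<open>w \<mapsto> E[\<phi>(Z) | W = w]\<close>, that is, a function
  whose composition with \<open>W\<close> is \<open>E[\<phi>(Z) | W]\<close>. It exists by the factorization
  lemma below and is unique almost everywhere with respect to the law of \<open>W\<close>.
\<close>

definition cond_exp_op ::
  "'m measure \<Rightarrow> ('m \<Rightarrow> real) \<Rightarrow> ('m \<Rightarrow> real) \<Rightarrow> (real \<Rightarrow> real) \<Rightarrow> real \<Rightarrow> real" where
  "cond_exp_op M Z W \<phi> =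
     (SOME g. g \<in> borel_measurable borel \<and>
        (AE \<omega> in M. g (W \<omega>) = real_cond_exp M (sigma_gen M W) (\<lambda>\<omega>. \<phi> (Z \<omega>)) \<omega>))"

lemma factor_ennreal:
  fixes f :: "'m \<Rightarrow> ennreal"
  assumes "f \<in> borel_measurable (vimage_algebra X W (borel :: real measure))"
  shows "\<exists>g\<in>borel_measurable borel. \<forall>x\<in>X. f x = g (W x)"
  using assms
proof (induction rule: borel_measurable_induct)
  case (cong f g)
  then show ?case by simp
next
  case (set A)
  then obtain B where B: "B \<in> sets borel" "A = W -` B \<inter> X"
    by (auto simp: sets_vimage_algebra2)
  show ?case
    by (rule bexI[of _ "indicator B"]) (use B in \<open>auto simp: indicator_def\<close>)
next
  case (mult u c)
  then obtain g where g: "g \<in> borel_measurable borel" "\<forall>x\<in>X. u x = g (W x)" by blast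
  show ?case
    by (rule bexI[of _ "\<lambda>y. c * g y"]) (use g in auto)
next
  case (add u v)
  then obtain g h where g: "g \<in> borel_measurable borel" "\<forall>x\<in>X. u x = g (W x)"
    and h: "h \<in> borel_measurable borel" "\<forall>x\<in>X. v x = h (W x)" by blast
  show ?case
    by (rule bexI[of _ "\<lambda>y. h y + g y"]) (use g h in auto)
next
  case (seq U)
  then have "\<forall>i. \<exists>g. g \<in> borel_measurable borel \<and> (\<forall>x\<in>X. U i x = g (W x))" by (simp add: Bex_def)
  from choice[OF this] obtain g
    where "\<forall>i. g i \<in> borel_measurable borel \<and> (\<forall>x\<in>X. U i x = g i (W x))" ..
  then have g: "\<And>i. g i \<in> borel_measurable borel" "\<And>i x. x \<in> X \<Longrightarrow> U i x = g i (W x)" by simp_all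
  show ?case
    by (rule bexI[of _ "\<lambda>y. SUP i. g i y"]) (use g in \<open>simp_all add: SUP_apply image_comp\<close>)
qed

lemma factor_real:
  fixes f :: "'m \<Rightarrow> real"
  assumes [measurable]: "f \<in> borel_measurable (vimage_algebra X W (borel :: real measure))"
  shows "\<exists>g\<in>borel_measurable borel. \<forall>x\<in>X. f x = g (W x)"
proof -
  obtain g h where g[measurable]: "g \<in> borel_measurable borel" "\<forall>x\<in>X. ennreal (f x) = g (W x)"
    and h[measurable]: "h \<in> borel_measurable borel" "\<forall>x\<in>X. ennreal (- f x) = h (W x)"
    using factor_ennreal[of "\<lambda>x. ennreal (f x)" X W] factor_ennreal[of "\<lambda>x. ennreal (- f x)" X W]
    by auto
  show ?thesis
  proof (rule bexI[of _ "\<lambda>y. enn2real (g y) - enn2real (h y)"])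
    show "\<forall>x\<in>X. f x = enn2real (g (W x)) - enn2real (h (W x))"
    proof
      fix x assume "x \<in> X"
      then have "g (W x) = ennreal (f x)" "h (W x) = ennreal (- f x)" using g h by auto
      then show "f x = enn2real (g (W x)) - enn2real (h (W x))"
        by (cases "f x \<ge> 0") (auto simp: ennreal_neg)
    qed
  qed measurable
qed

lemma cond_exp_op_version:
  "cond_exp_op M Z W \<phi> \<in> borel_measurable borel \<and>
   (AE \<omega> in M. cond_exp_op M Z W \<phi> (W \<omega>) = real_cond_exp M (sigma_gen M W) (\<lambda>\<omega>. \<phi> (Z \<omega>)) \<omega>)"
proof -
  have "real_cond_exp M (sigma_gen M W) (\<lambda>\<omega>. \<phi> (Z \<omega>)) \<in> borel_measurable (sigma_gen M W)"
    by (rule borel_measurable_cond_exp)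
  from factor_real[OF this] obtain g where g: "g \<in> borel_measurable borel"
    "\<forall>\<omega>\<in>space M. real_cond_exp M (sigma_gen M W) (\<lambda>\<omega>. \<phi> (Z \<omega>)) \<omega> = g (W \<omega>)" ..
  from g(2) have "AE \<omega> in M. g (W \<omega>) = real_cond_exp M (sigma_gen M W) (\<lambda>\<omega>. \<phi> (Z \<omega>)) \<omega>"
    by (intro AE_I2) simp
  with g(1) have "\<exists>g. g \<in> borel_measurable borel \<and>
        (AE \<omega> in M. g (W \<omega>) = real_cond_exp M (sigma_gen M W) (\<lambda>\<omega>. \<phi> (Z \<omega>)) \<omega>)"
    by (intro exI conjI)
  then show ?thesis unfolding cond_exp_op_def by (rule someI_ex)
qed

section \<open>The statistical model\<close>

text \<open>
  An error term, possibly living on an enlargement of the probability space carrying \<open>(Z, W)\<close>,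
  enters only through the joint law \<open>Q\<close> of \<open>(U, Z, W)\<close>. Hence it is represented by a probability
  measure \<open>Q\<close> on triples \<open>(u, z, w)\<close> under which the last two coordinates have the given law of
  \<open>(Z, W)\<close>.
\<close>

definition error_class ::
  "'m measure \<Rightarrow> ('m \<Rightarrow> real) \<Rightarrow> ('m \<Rightarrow> real) \<Rightarrow> real \<Rightarrow> (real \<times> real \<times> real) measure set" where
  "error_class M Z W \<sigma> =
     {Q. prob_space Q \<and> sets Q = sets borel \<and>
         distr Q borel snd = distr M borel (\<lambda>\<omega>. (Z \<omega>, W \<omega>)) \<and>
         integrable Q (\<lambda>(u, z, w). u) \<and>
         (AE x in Q. real_cond_exp Q (sigma_gen Q (\<lambda>(u, z, w). w)) (\<lambda>(u, z, w). u) x = 0) \<and>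
         (AE x in Q. nn_cond_exp Q (sigma_gen Q (\<lambda>(u, z, w). w)) (\<lambda>(u, z, w). ennreal (u ^ 4)) x
                       \<le> ennreal (\<sigma> ^ 4))}"

definition observation_law ::
  "(real \<times> real \<times> real) measure \<Rightarrow> (real \<Rightarrow> real) \<Rightarrow> (real \<times> real \<times> real) measure" where
  "observation_law Q \<phi> = distr Q borel (\<lambda>(u, z, w). (\<phi> z + u, z, w))"

definition sample_law ::
  "nat \<Rightarrow> (real \<times> real \<times> real) measure \<Rightarrow> (real \<Rightarrow> real) \<Rightarrow> (nat \<Rightarrow> real \<times> real \<times> real) measure" where
  "sample_law n Q \<phi> = (\<Pi>\<^sub>M i\<in>{1..n}. observation_law Q \<phi>)"

text \<open>The estimator may depend on the known representer, which is its first argument.\<close>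

definition estimators ::
  "nat \<Rightarrow> ((real \<Rightarrow> real) \<Rightarrow> (nat \<Rightarrow> real \<times> real \<times> real) \<Rightarrow> real) set" where
  "estimators n = {est. \<forall>h\<in>L2_unit. est h \<in> borel_measurable (\<Pi>\<^sub>M i\<in>{1..n}. borel)}"

definition target :: "'m measure \<Rightarrow> ('m \<Rightarrow> real) \<Rightarrow> (real \<Rightarrow> real) \<Rightarrow> (real \<Rightarrow> real) \<Rightarrow> real" where
  "target M Z h \<phi> = (LINT \<omega>|M. h (Z \<omega>) * \<phi> (Z \<omega>))"

definition max_risk ::
  "'m measure \<Rightarrow> ('m \<Rightarrow> real) \<Rightarrow> ('m \<Rightarrow> real) \<Rightarrow> real \<Rightarrow> (real \<Rightarrow> real) set \<Rightarrow> (real \<Rightarrow> real) set \<Rightarrow>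
   nat \<Rightarrow> ((real \<Rightarrow> real) \<Rightarrow> (nat \<Rightarrow> real \<times> real \<times> real) \<Rightarrow> real) \<Rightarrow> ennreal" where
  "max_risk M Z W \<sigma> \<Phi> H n est =
     (SUP Q\<in>error_class M Z W \<sigma>. SUP \<phi>\<in>\<Phi>. SUP h\<in>H.
        \<integral>\<^sup>+ x. ennreal (\<bar>est h x - target M Z h \<phi>\<bar>\<^sup>2) \<partial>sample_law n Q \<phi>)"

end

theory Submission
  imports Defs
begin

text \<open>
  The observable law of \<open>(Y, Z, W)\<close> depends on the structural function \<open>\<phi>\<close> and on the error law, and
  the error law is at our disposal. It can be chosen such that \<open>\<phi>\<close> is visible only through its
  smoothed image \<open>T \<phi>\<close>: whenever \<open>\<bar>\<phi>\<bar> \<le> 1\<close>, let \<open>Y\<close> take the values \<open>1\<close> and \<open>-1\<close> with conditional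
  probabilities \<open>(1 + T \<phi>(W)) / 2\<close> and \<open>(1 - T \<phi>(W)) / 2\<close> given \<open>(Z, W)\<close>. The error
  \<open>U = Y - \<phi>(Z)\<close> then satisfies \<open>E[U | W] = T \<phi>(W) - E[\<phi>(Z) | W] = 0\<close> and \<open>\<bar>U\<bar> \<le> 2\<close>, so it belongs to the error class
  as soon as \<open>\<sigma> \<ge> 2\<close> (\<open>binary_response_error_in_error_class\<close>).

  The likelihood ratio of this law to that for \<open>\<phi> = 0\<close>, where \<open>Y\<close> is a fair coin, is
  \<open>1 + Y T \<phi>(W)\<close>. Its second moment is \<open>1 + \<parallel>T \<phi>\<parallel>\<^sup>2\<close> for one observation and at most
  \<open>exp (n \<parallel>T \<phi>\<parallel>\<^sup>2)\<close> for a sample of size \<open>n\<close>. If \<open>n \<parallel>T \<phi>\<parallel>\<^sup>2\<close> stays bounded, no estimator can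
  do well under both hypotheses, and the worse of the two risks is at least a constant times
  \<open>\<langle>h, \<phi>\<rangle>\<^sup>2\<close> (\<open>chi_square_two_point_bound_product\<close>, \<open>max_risk_two_point\<close>).

  With \<open>\<phi> = \<theta> e\<^sub>j\<close> and \<open>h = \<kappa> e\<^sub>j\<close> the link condition gives \<open>\<parallel>T \<phi>\<parallel>\<^sup>2 \<le> d v\<^sub>j \<theta>\<^sup>2\<close>, and the ellipsoids
  allow \<open>\<theta>\<close> of order \<open>j\<^bsup>-p\<^esup>\<close> and \<open>\<kappa>\<close> of order \<open>j\<^bsup>-s\<^esup>\<close>. Hence the risk is at least of order
  \<open>j\<^bsup>-2(p+s)\<^esup>\<close> for every \<open>j\<close> with \<open>n v\<^sub>j j\<^bsup>-2p\<^esup> \<le> 1\<close>. Frequencies of order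
  \<open>n\<^bsup>1/(2(p+a))\<^esup>\<close> in the polynomial case and \<open>(ln n)\<^bsup>1/(2a)\<^esup>\<close> in the
  exponential case satisfy this, and yield the nonparametric rates. The rate \<open>1 / n\<close> comes from
  \<open>j = 1\<close> with \<open>\<theta>\<close> of order \<open>1 / sqrt n\<close>.
\<close>

section \<open>Indistinguishable hypotheses\<close>

text \<open>
  If \<open>L\<close> is the density of the alternative with respect to \<open>P\<close>, the number \<open>C\<close> bounds one plus
  the \<open>\<chi>\<^sup>2\<close>-divergence between the two hypotheses, under which the estimated quantity equals
  \<open>0\<close> and \<open>\<Delta>\<close>. At a single point the combined loss \<open>b\<^sup>2 + L (b - \<Delta>)\<^sup>2\<close> is at least
  \<open>\<Delta>\<^sup>2 L / (1 + L)\<close>; the parabola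
  \<open>\<Delta>\<^sup>2 (2 l L - l\<^sup>2 (L + L\<^sup>2))\<close> lies below it for every \<open>l\<close>, and its integral only involves the first two
  moments of \<open>L\<close>. The choice \<open>l = 1 / (1 + C)\<close> gives the best bound.
\<close>

lemma chi_square_two_point_bound:
  fixes L e :: "'a \<Rightarrow> real" and C \<Delta> :: real
  assumes [measurable]: "L \<in> borel_measurable P" "e \<in> borel_measurable P"
    and L0: "\<And>x. x \<in> space P \<Longrightarrow> 0 \<le> L x"
    and L1: "(\<integral>\<^sup>+ x. ennreal (L x) \<partial>P) = 1"
    and L2: "(\<integral>\<^sup>+ x. ennreal ((L x)\<^sup>2) \<partial>P) \<le> ennreal C"
    and C: "0 \<le> C"
  shows "ennreal (\<Delta>\<^sup>2 / (1 + C)) \<le>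
    (\<integral>\<^sup>+ x. ennreal (\<bar>e x\<bar>\<^sup>2) \<partial>P) +
    (\<integral>\<^sup>+ x. ennreal (\<bar>e x - \<Delta>\<bar>\<^sup>2) \<partial>density P (\<lambda>x. ennreal (L x)))"
proof -
  define l where "l = 1 / (1 + C)"
  have l: "0 \<le> l" "l * (1 + C) = 1" using C by (auto simp: l_def)
  let ?A = "\<integral>\<^sup>+ x. ennreal (\<bar>e x\<bar>\<^sup>2) \<partial>P"
  let ?B = "\<integral>\<^sup>+ x. ennreal (\<bar>e x - \<Delta>\<bar>\<^sup>2) \<partial>density P (\<lambda>x. ennreal (L x))"
  have B: "?B = (\<integral>\<^sup>+ x. ennreal (L x * (e x - \<Delta>)\<^sup>2) \<partial>P)"
    by (subst nn_integral_density) (auto intro!: nn_integral_cong simp: ennreal_mult' L0)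
  have pointwise: "2 * l * \<Delta>\<^sup>2 * y \<le> b\<^sup>2 + y * (b - \<Delta>)\<^sup>2 + \<Delta>\<^sup>2 * l\<^sup>2 * (y + y\<^sup>2)"
    if "0 \<le> y" for y b
  proof -
    have "(1 + y) * (b\<^sup>2 + y * (b - \<Delta>)\<^sup>2 + \<Delta>\<^sup>2 * l\<^sup>2 * (y + y\<^sup>2) - 2 * l * \<Delta>\<^sup>2 * y)
        = ((1 + y) * b - y * \<Delta>)\<^sup>2 + y * \<Delta>\<^sup>2 * (1 - l * (1 + y))\<^sup>2"
      by (simp add: power2_eq_square algebra_simps)
    also have "\<dots> \<ge> 0" using that by simp
    finally show ?thesis using that by (simp add: zero_le_mult_iff)
  qed
  \<comment> \<open>Negative terms are moved to the other side, so that only nonnegative integrals occur.\<close>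
  have "ennreal (2 * l * \<Delta>\<^sup>2) = (\<integral>\<^sup>+ x. ennreal (2 * l * \<Delta>\<^sup>2) * ennreal (L x) \<partial>P)"
    by (subst nn_integral_cmult) (auto simp: L1)
  also have "\<dots> = (\<integral>\<^sup>+ x. ennreal (2 * l * \<Delta>\<^sup>2 * L x) \<partial>P)"
    using l by (intro nn_integral_cong) (auto simp: ennreal_mult' L0)
  also have "\<dots> \<le> (\<integral>\<^sup>+ x. ennreal (\<bar>e x\<bar>\<^sup>2) + ennreal (L x * (e x - \<Delta>)\<^sup>2)
      + ennreal (\<Delta>\<^sup>2 * l\<^sup>2) * (ennreal (L x) + ennreal ((L x)\<^sup>2)) \<partial>P)"
  proof (intro nn_integral_mono)
    fix x assume x: "x \<in> space P"
    have "ennreal (\<bar>e x\<bar>\<^sup>2) + ennreal (L x * (e x - \<Delta>)\<^sup>2)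
      + ennreal (\<Delta>\<^sup>2 * l\<^sup>2) * (ennreal (L x) + ennreal ((L x)\<^sup>2))
      = ennreal ((e x)\<^sup>2 + L x * (e x - \<Delta>)\<^sup>2 + \<Delta>\<^sup>2 * l\<^sup>2 * (L x + (L x)\<^sup>2))"
      using L0[OF x] by (simp flip: ennreal_plus ennreal_mult')
    then show "ennreal (2 * l * \<Delta>\<^sup>2 * L x) \<le> ennreal (\<bar>e x\<bar>\<^sup>2) + ennreal (L x * (e x - \<Delta>)\<^sup>2)
      + ennreal (\<Delta>\<^sup>2 * l\<^sup>2) * (ennreal (L x) + ennreal ((L x)\<^sup>2))"
      using pointwise[OF L0[OF x], of "e x"] by (simp add: ennreal_leI)
  qed
  also have "\<dots> = ?A + ?B + ennreal (\<Delta>\<^sup>2 * l\<^sup>2) * (1 + (\<integral>\<^sup>+ x. ennreal ((L x)\<^sup>2) \<partial>P))"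
    unfolding B by (simp add: nn_integral_add nn_integral_cmult L1)
  also have "\<dots> \<le> ?A + ?B + ennreal (\<Delta>\<^sup>2 * l\<^sup>2) * (1 + ennreal C)"
    by (intro add_left_mono mult_left_mono L2) auto
  also have "ennreal (\<Delta>\<^sup>2 * l\<^sup>2) * (1 + ennreal C) = ennreal (l * \<Delta>\<^sup>2)"
  proof -
    have "ennreal (\<Delta>\<^sup>2 * l\<^sup>2) * (1 + ennreal C) = ennreal (\<Delta>\<^sup>2 * l\<^sup>2 * (1 + C))"
      using C by (simp add: ennreal_mult'  flip: ennreal_1 ennreal_plus)
    also have "\<Delta>\<^sup>2 * l\<^sup>2 * (1 + C) = \<Delta>\<^sup>2 * l * (l * (1 + C))"
      by (simp add: power2_eq_square)
    finally show ?thesis using l by (simp add: mult.commute)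
  qed
  finally have main: "ennreal (2 * l * \<Delta>\<^sup>2) \<le> ?A + ?B + ennreal (l * \<Delta>\<^sup>2)" .
  have "ennreal (2 * l * \<Delta>\<^sup>2) = ennreal (l * \<Delta>\<^sup>2) + ennreal (l * \<Delta>\<^sup>2)"
    using l by (simp flip: ennreal_plus)
  with main have "ennreal (l * \<Delta>\<^sup>2) + ennreal (l * \<Delta>\<^sup>2) \<le> ennreal (l * \<Delta>\<^sup>2) + (?A + ?B)"
    by (simp only: add.commute)
  then have "ennreal (l * \<Delta>\<^sup>2) \<le> ?A + ?B"
    unfolding ennreal_add_left_cancel_le by simp
  then show ?thesis by (simp add: l_def)
qed

text \<open>
  Both measures agree on boxes, where the integral of a product of one-variable functions factorizes.
\<close>

lemma PiM_density:
  assumes I: "finite I" and N: "sigma_finite_measure N"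
    and f[measurable]: "f \<in> borel_measurable N"
    and Nf: "sigma_finite_measure (density N f)"
  shows "PiM I (\<lambda>_. density N f) = density (PiM I (\<lambda>_. N)) (\<lambda>x. \<Prod>i\<in>I. f (x i))"
proof -
  interpret N: product_sigma_finite "\<lambda>_. N" by standard (rule sigma_finite_measure.sigma_finite_countable[OF N])
  interpret D: product_sigma_finite "\<lambda>_. density N f" by standard (rule sigma_finite_measure.sigma_finite_countable[OF Nf])
  have sets: "sets (PiM I (\<lambda>_. density N f)) = sets (PiM I (\<lambda>_. N))"
    by (intro sets_PiM_cong) auto
  show ?thesis
  proof (rule D.PiM_eqI[OF I, symmetric])
    show "sets (density (PiM I (\<lambda>_. N)) (\<lambda>x. \<Prod>i\<in>I. f (x i))) = sets (PiM I (\<lambda>_. density N f))"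
      by (simp add: sets)
    fix A assume "\<And>i. i \<in> I \<Longrightarrow> A i \<in> sets (density N f)"
    then have A: "A i \<in> sets N" if "i \<in> I" for i using that by simp
    have "emeasure (density (PiM I (\<lambda>_. N)) (\<lambda>x. \<Prod>i\<in>I. f (x i))) (Pi\<^sub>E I A)
        = (\<integral>\<^sup>+ x. (\<Prod>i\<in>I. f (x i)) * indicator (Pi\<^sub>E I A) x \<partial>PiM I (\<lambda>_. N))"
      using I A by (intro emeasure_density) (auto intro!: sets_PiM_I_finite)
    also have "\<dots> = (\<integral>\<^sup>+ x. (\<Prod>i\<in>I. f (x i) * indicator (A i) (x i)) \<partial>PiM I (\<lambda>_. N))"
    proof (rule nn_integral_cong)
      fix x assume "x \<in> space (PiM I (\<lambda>_. N))"
      then have "x \<in> extensional I" by (auto simp: space_PiM PiE_def)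
      then have "(indicator (Pi\<^sub>E I A) x :: ennreal) = (\<Prod>i\<in>I. indicator (A i) (x i))"
        using I by (auto simp: indicator_def PiE_def Pi_def prod_zero_iff)
      then show "(\<Prod>i\<in>I. f (x i)) * indicator (Pi\<^sub>E I A) x = (\<Prod>i\<in>I. f (x i) * indicator (A i) (x i))"
        by (simp add: prod.distrib)
    qed
    also have "\<dots> = (\<Prod>i\<in>I. \<integral>\<^sup>+ x. f x * indicator (A i) x \<partial>N)"
      using A by (intro N.product_nn_integral_prod[OF I]) auto
    also have "\<dots> = (\<Prod>i\<in>I. emeasure (density N f) (A i))"
      using A by (intro prod.cong refl) (auto simp: emeasure_density)
    finally show "emeasure (density (PiM I (\<lambda>_. N)) (\<lambda>x. \<Prod>i\<in>I. f (x i))) (Pi\<^sub>E I A)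
        = (\<Prod>i\<in>I. emeasure (density N f) (A i))" .
  qed
qed

text \<open>
  The second moment of a likelihood ratio is multiplicative over independent observations, so that of
  a sample is at most \<open>(1 + \<delta>)\<close> to the power of the sample size, hence at most \<open>exp K\<close>: hypotheses at
  \<open>\<chi>\<^sup>2\<close>-distance of order one over the sample size cannot be told apart.
\<close>

lemma chi_square_two_point_bound_product:
  fixes L :: "'a \<Rightarrow> real" and e :: "('i \<Rightarrow> 'a) \<Rightarrow> real" and \<Delta> \<delta> K :: real
  assumes N: "prob_space N" and I: "finite I"
    and L [measurable]: "L \<in> borel_measurable N" and L0: "\<And>x. 0 \<le> L x"
    and L1: "(\<integral>\<^sup>+ x. ennreal (L x) \<partial>N) = 1"
    and L2: "(\<integral>\<^sup>+ x. ennreal ((L x)\<^sup>2) \<partial>N) \<le> ennreal (1 + \<delta>)"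
    and \<delta>: "0 \<le> \<delta>" "real (card I) * \<delta> \<le> K"
    and e: "e \<in> borel_measurable (PiM I (\<lambda>_. N))"
  shows "ennreal (\<Delta>\<^sup>2 / (1 + exp K)) \<le>
    (\<integral>\<^sup>+ x. ennreal (\<bar>e x\<bar>\<^sup>2) \<partial>PiM I (\<lambda>_. N)) +
    (\<integral>\<^sup>+ x. ennreal (\<bar>e x - \<Delta>\<bar>\<^sup>2) \<partial>PiM I (\<lambda>_. density N (\<lambda>x. ennreal (L x))))"
proof -
  interpret N: prob_space N by (rule N)
  interpret product_prob_space "\<lambda>_. N" by standard
  have "prob_space (density N (\<lambda>x. ennreal (L x)))"
    by (rule prob_spaceI) (simp add: emeasure_density L1 nn_integral_set_ennreal cong: nn_integral_cong)
  then have "PiM I (\<lambda>_. density N (\<lambda>x. ennreal (L x))) =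
      density (PiM I (\<lambda>_. N)) (\<lambda>x. \<Prod>i\<in>I. ennreal (L (x i)))"
    by (intro PiM_density I prob_space_imp_sigma_finite N) simp_all
  also have "(\<lambda>x. \<Prod>i\<in>I. ennreal (L (x i))) = (\<lambda>x. ennreal (\<Prod>i\<in>I. L (x i)))"
    by (simp add: prod_ennreal L0)
  finally have density: "PiM I (\<lambda>_. density N (\<lambda>x. ennreal (L x))) =
      density (PiM I (\<lambda>_. N)) (\<lambda>x. ennreal (\<Prod>i\<in>I. L (x i)))" .
  have one: "(\<integral>\<^sup>+ x. ennreal (\<Prod>i\<in>I. L (x i)) \<partial>PiM I (\<lambda>_. N)) = 1"
    using product_nn_integral_prod[OF I, of "\<lambda>_ x. ennreal (L x)"]
    by (simp add: L1 prod_ennreal L0)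
  have "(\<integral>\<^sup>+ x. ennreal ((\<Prod>i\<in>I. L (x i))\<^sup>2) \<partial>PiM I (\<lambda>_. N)) =
      (\<Prod>i\<in>I. \<integral>\<^sup>+ x. ennreal ((L x)\<^sup>2) \<partial>N)"
    using product_nn_integral_prod[OF I, of "\<lambda>_ x. ennreal ((L x)\<^sup>2)"]
    by (simp add: prod_ennreal prod_power_distrib)
  also have "\<dots> \<le> ennreal (1 + \<delta>) ^ card I"
    using power_mono[OF L2] by simp
  also have "\<dots> = ennreal ((1 + \<delta>) ^ card I)"
    using \<delta> by (intro ennreal_power) auto
  also have "\<dots> \<le> ennreal (exp K)"
  proof (rule ennreal_leI)
    have "(1 + \<delta>) ^ card I \<le> exp \<delta> ^ card I"
      using \<delta> by (intro power_mono exp_ge_add_one_self) auto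
    also have "\<dots> = exp (real (card I) * \<delta>)"
      by (simp add: exp_of_nat_mult)
    also have "\<dots> \<le> exp K"
      using \<delta> by simp
    finally show "(1 + \<delta>) ^ card I \<le> exp K" .
  qed
  finally have two: "(\<integral>\<^sup>+ x. ennreal ((\<Prod>i\<in>I. L (x i))\<^sup>2) \<partial>PiM I (\<lambda>_. N)) \<le> ennreal (exp K)" .
  show ?thesis
    unfolding density
    by (rule chi_square_two_point_bound) (use one two e in \<open>auto intro: prod_nonneg L0\<close>)
qed

section \<open>Orthonormality of the trigonometric basis\<close>

lemma unit_unif_eq_density: "unit_unif = density lborel (\<lambda>t. ennreal (indicator {0..1} t))"
  by (simp add: uniform_measure_def divide_ennreal_def ennreal_indicator)

text \<open>
  Integer frequencies of either sign, including zero, make the product-to-sum formulas applicable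
  without case distinctions.
\<close>

lemma has_integral_cos_int:
  fixes m :: int
  shows "has_bochner_integral unit_unif (\<lambda>t. cos (2 * pi * of_int m * t)) (of_bool (m = 0))"
proof -
  define F where "F t = (if m = 0 then t else sin (2 * pi * of_int m * t) / (2 * pi * of_int m))" for t
  have "DERIV F t :> cos (2 * pi * of_int m * t)" for t
    unfolding F_def by (cases "m = 0") (auto intro!: derivative_eq_intros)
  then have "has_bochner_integral lborel (\<lambda>t. cos (2 * pi * of_int m * t) * indicator {0..1} t) (F 1 - F 0)"
    by (intro has_bochner_integral_FTC_Icc_real) (auto intro!: continuous_intros)
  also have "F 1 - F 0 = of_bool (m = 0)"
    by (simp add: F_def sin_int_2pin)
  finally show ?thesis
    unfolding unit_unif_eq_density
    by (intro has_bochner_integral_density) (auto simp: mult.commute)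
qed

lemma has_integral_sin_int:
  fixes m :: int
  shows "has_bochner_integral unit_unif (\<lambda>t. sin (2 * pi * of_int m * t)) 0"
proof -
  define F where "F t = (if m = 0 then 0 else - cos (2 * pi * of_int m * t) / (2 * pi * of_int m))" for t
  have "DERIV F t :> sin (2 * pi * of_int m * t)" for t
    unfolding F_def by (cases "m = 0") (auto intro!: derivative_eq_intros)
  then have "has_bochner_integral lborel (\<lambda>t. sin (2 * pi * of_int m * t) * indicator {0..1} t) (F 1 - F 0)"
    by (intro has_bochner_integral_FTC_Icc_real) (auto intro!: continuous_intros)
  also have "F 1 - F 0 = 0"
    by (simp add: F_def cos_int_2pin)
  finally show ?thesis
    unfolding unit_unif_eq_density
    by (intro has_bochner_integral_density) (auto simp: mult.commute)
qed

lemma l2_inner_trig_basis: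
  assumes "1 \<le> i" "1 \<le> j"
  shows "l2_inner (trig_basis i) (trig_basis j) = of_bool (i = j)"
proof -
  define k l where "k = int (i div 2)" and "l = int (j div 2)"
  let ?c = "\<lambda>m t. cos (2 * pi * of_int m * t)" and ?s = "\<lambda>m t. sin (2 * pi * of_int m * t)"
  have c: "has_bochner_integral unit_unif (?c m) (of_bool (m = 0))"
    and s: "has_bochner_integral unit_unif (?s m) 0" for m
    by (rule has_integral_cos_int has_integral_sin_int)+
  \<comment> \<open>The constant function is the cosine of frequency zero, up to the normalizing factor.\<close>
  have rep: "trig_basis n = (\<lambda>t. (if n = 1 then 1 else sqrt 2) *
      (if even n \<or> n = 1 then ?c (int (n div 2)) t else ?s (int (n div 2)) t))" for n
    by (auto simp: trig_basis_def fun_eq_iff)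
  have cc: "has_bochner_integral unit_unif (\<lambda>t. ?c k t * ?c l t) ((of_bool (k = l) + of_bool (k + l = 0)) / 2)"
    using has_bochner_integral_divide[OF has_bochner_integral_add[OF c[of "k - l"] c[of "k + l"]], of 2]
    by (simp add: cos_times_cos algebra_simps)
  have ss: "has_bochner_integral unit_unif (\<lambda>t. ?s k t * ?s l t) ((of_bool (k = l) - of_bool (k + l = 0)) / 2)"
    using has_bochner_integral_divide[OF has_bochner_integral_diff[OF c[of "k - l"] c[of "k + l"]], of 2]
    by (simp add: sin_times_sin algebra_simps)
  have cs: "has_bochner_integral unit_unif (\<lambda>t. ?c k t * ?s l t) 0" for k l
    using has_bochner_integral_divide[OF has_bochner_integral_diff[OF s[of "k + l"] s[of "k - l"]], of 2]
    by (simp add: cos_times_sin algebra_simps)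
  have sc: "has_bochner_integral unit_unif (\<lambda>t. ?s k t * ?c l t) 0"
    using cs[of l k] by (simp add: mult.commute)
  note ints = cc[THEN has_bochner_integral_integral_eq] ss[THEN has_bochner_integral_integral_eq]
    sc[THEN has_bochner_integral_integral_eq] cs[of k l, THEN has_bochner_integral_integral_eq]
  define x y :: real where "x = (if i = 1 then 1 else sqrt 2)" and "y = (if j = 1 then 1 else sqrt 2)"
  define A B where "A t = (if even i \<or> i = 1 then ?c k t else ?s k t)"
    and "B t = (if even j \<or> j = 1 then ?c l t else ?s l t)" for t
  have "l2_inner (trig_basis i) (trig_basis j) = (LINT t|unit_unif. (x * y) * (A t * B t))"
    unfolding l2_inner_def rep x_def y_def A_def B_def k_def l_def
    by (intro Bochner_Integration.integral_cong) (auto simp: ac_simps)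
  also have "\<dots> = x * y * (LINT t|unit_unif. A t * B t)"
    by simp
  also have "(LINT t|unit_unif. A t * B t) =
     (if even i \<or> i = 1 then if even j \<or> j = 1 then (of_bool (k = l) + of_bool (k + l = 0)) / 2 else 0
      else if even j \<or> j = 1 then 0 else (of_bool (k = l) - of_bool (k + l = 0)) / 2)"
    using ints by (simp add: A_def B_def)
  also have "x * y * \<dots> = of_bool (i = j)"
    using assms unfolding x_def y_def k_def l_def
    by (auto elim!: evenE oddE)
  finally show ?thesis .
qed

lemma trig_basis_measurable [measurable]: "trig_basis j \<in> borel_measurable borel"
  unfolding trig_basis_def[abs_def] by measurable

lemma abs_trig_basis_le: "\<bar>trig_basis j t\<bar> \<le> sqrt 2"
proof -
  have "sqrt 2 * \<bar>u\<bar> \<le> sqrt 2" if "\<bar>u\<bar> \<le> 1" for u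
    using mult_left_mono[OF that, of "sqrt 2"] by simp
  then show ?thesis
    by (auto simp: trig_basis_def abs_mult)
qed

lemma prob_space_unit_unif: "prob_space unit_unif"
  by (rule prob_space_uniform_measure) auto

lemma scaled_trig_basis_in_L2: "(\<lambda>t. c * trig_basis j t) \<in> L2_unit"
proof -
  interpret prob_space unit_unif by (rule prob_space_unit_unif)
  have "(c * trig_basis j t)\<^sup>2 \<le> c\<^sup>2 * 2" for t
    using power_mono[OF abs_trig_basis_le[of j t], of 2] by (simp add: power_mult_distrib mult_left_mono)
  then have "integrable unit_unif (\<lambda>t. (c * trig_basis j t)\<^sup>2)"
    by (intro integrable_const_bound[where B = "c\<^sup>2 * 2"]) auto
  then show ?thesis
    by (simp add: L2_unit_def)
qed

lemma weighted_sq_norm_scaled_trig_basis: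
  assumes "1 \<le> j" "0 \<le> v j"
  shows "weighted_sq_norm v (\<lambda>t. c * trig_basis j t) = ennreal (v j * c\<^sup>2)"
proof -
  have inner: "l2_inner (\<lambda>t. c * trig_basis j t) (trig_basis i) = c * of_bool (i = j)" if "1 \<le> i" for i
  proof -
    have "l2_inner (\<lambda>t. c * trig_basis j t) (trig_basis i) = c * l2_inner (trig_basis j) (trig_basis i)"
      by (simp add: l2_inner_def mult.assoc)
    then show ?thesis
      using assms that by (auto simp: l2_inner_trig_basis)
  qed
  have "(\<Sum>k. ennreal (v (Suc k) * (l2_inner (\<lambda>t. c * trig_basis j t) (trig_basis (Suc k)))\<^sup>2)) =
    (\<Sum>k\<in>{j - 1}. ennreal (v (Suc k) * (l2_inner (\<lambda>t. c * trig_basis j t) (trig_basis (Suc k)))\<^sup>2))"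
    by (rule suminf_finite) (auto simp: inner)
  also have "\<dots> = ennreal (v j * c\<^sup>2)"
    using assms by (simp add: inner)
  finally show ?thesis
    by (simp add: weighted_sq_norm_def)
qed

lemma sobolev_weight_eq: "1 \<le> j \<Longrightarrow> sobolev_weight j = (real j)\<^sup>2"
  by (auto simp: sobolev_weight_def)

lemma scaled_trig_basis_in_sobolev_ellipsoid:
  assumes "1 \<le> j" "c\<^sup>2 * sobolev_weight j powr r \<le> b"
  shows "(\<lambda>t. c * trig_basis j t) \<in> sobolev_ellipsoid r b"
  using assms scaled_trig_basis_in_L2
  by (simp add: sobolev_ellipsoid_def weighted_sq_norm_scaled_trig_basis mult.commute ennreal_leI)

section \<open>Binary responses with prescribed conditional mean\<close>

definition coin :: "real measure" where
  "coin = distr (measure_pmf (pmf_of_set {-1, 1})) borel (\<lambda>y. y)"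

lemma prob_space_coin: "prob_space coin"
  unfolding coin_def by (intro prob_space.prob_space_distr prob_space_measure_pmf) auto

lemma sets_coin [measurable_cong, simp]: "sets coin = sets borel"
  by (simp add: coin_def)

lemma nn_integral_coin:
  assumes "f \<in> borel_measurable borel"
  shows "(\<integral>\<^sup>+ y. f y \<partial>coin) = (f (-1) + f 1) / 2"
  using assms unfolding coin_def
  by (subst nn_integral_distr) (auto simp: nn_integral_pmf_of_set)

lemma integral_coin:
  fixes f :: "real \<Rightarrow> real"
  assumes "f \<in> borel_measurable borel"
  shows "(\<integral> y. f y \<partial>coin) = (f (-1) + f 1) / 2"
  using assms unfolding coin_def
  by (subst integral_distr) (auto simp: integral_pmf_of_set)

text \<open>
  Here \<open>R\<close> is the law of \<open>(Z, W)\<close>. Given \<open>(Z, W)\<close>, the response takes the values \<open>1\<close> and \<open>-1\<close> with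
  probabilities \<open>(1 + g(W)) / 2\<close> and \<open>(1 - g(W)) / 2\<close>, so that its conditional mean is \<open>g(W)\<close>.
\<close>

definition binary_response_law :: "(real \<times> real) measure \<Rightarrow> (real \<Rightarrow> real) \<Rightarrow> (real \<times> real \<times> real) measure" where
  "binary_response_law R g = density (coin \<Otimes>\<^sub>M R) (\<lambda>(y, z, w). ennreal (1 + y * g w))"

lemma sets_borel_triple [measurable_cong]: "sets (borel :: (real \<times> real \<times> real) measure) = sets (borel \<Otimes>\<^sub>M borel \<Otimes>\<^sub>M borel)"
  by (simp only: borel_prod)

lemma sets_borel_pair [measurable_cong]: "sets (borel :: (real \<times> real) measure) = sets (borel \<Otimes>\<^sub>M borel)"
  by (simp only: borel_prod)

lemma AE_coin: "AE y in coin. \<bar>y\<bar> \<le> 1"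
  unfolding coin_def by (subst AE_distr_iff) (auto simp: AE_measure_pmf_iff)

context
  fixes R :: "(real \<times> real) measure" and g :: "real \<Rightarrow> real"
  assumes R: "prob_space R" and sets_R: "sets R = sets borel"
    and g_meas [measurable]: "g \<in> borel_measurable borel" and g_le: "\<And>w. \<bar>g w\<bar> \<le> 1"
begin

lemma response_weights_sum: "ennreal (1 + g w) + ennreal (1 - g w) = 2"
  using g_le[of w] ennreal_plus[of "1 + g w" "1 - g w"] by (simp add: abs_le_iff)

lemma sets_R_pair [measurable_cong]: "sets R = sets (borel \<Otimes>\<^sub>M borel)"
  by (simp add: sets_R sets_borel_pair)

lemma sets_coin_pair: "sets (coin \<Otimes>\<^sub>M R) = sets borel"
  using sets_pair_measure_cong[OF sets_coin sets_R_pair] by (simp only: sets_borel_triple)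

lemma sets_binary_response_law: "sets (binary_response_law R g) = sets borel"
  by (simp only: binary_response_law_def sets_density sets_coin_pair)

lemma measurable_on_coin_pair: "f \<in> borel_measurable borel \<Longrightarrow> f \<in> borel_measurable (coin \<Otimes>\<^sub>M R)"
  by (simp add: measurable_cong_sets[OF sets_coin_pair refl])

lemma pair_prob_space_coin: "pair_prob_space coin R"
  using R prob_space_coin
  by (simp add: pair_prob_space_def pair_sigma_finite_def prob_space_imp_sigma_finite)

lemma nn_integral_coin_pair:
  assumes f: "f \<in> borel_measurable borel"
  shows "(\<integral>\<^sup>+ x. f x \<partial>(coin \<Otimes>\<^sub>M R)) =
    ((\<integral>\<^sup>+ (z, w). f (1, z, w) \<partial>R) + (\<integral>\<^sup>+ (z, w). f (-1, z, w) \<partial>R)) / 2"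
proof -
  interpret pair_prob_space coin R by (rule pair_prob_space_coin)
  note f' [measurable] = measurable_on_coin_pair[OF f]
  have "(\<integral>\<^sup>+ x. f x \<partial>(coin \<Otimes>\<^sub>M R)) = (\<integral>\<^sup>+ y. \<integral>\<^sup>+ v. f (y, v) \<partial>R \<partial>coin)"
    by (simp add: M2.nn_integral_fst)
  also have "\<dots> = ((\<integral>\<^sup>+ v. f (-1, v) \<partial>R) + (\<integral>\<^sup>+ v. f (1, v) \<partial>R)) / 2"
    by (rule nn_integral_coin) measurable
  finally show ?thesis
    by (simp add: add.commute case_prod_unfold)
qed

lemma density_coin_pair_measurable [measurable]:
  "(\<lambda>(y, z :: real, w). ennreal (1 + y * g w)) \<in> borel_measurable borel"
  by measurable

lemma nn_integral_binary_response_law: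
  assumes f: "f \<in> borel_measurable borel"
  shows "(\<integral>\<^sup>+ x. f x \<partial>binary_response_law R g) =
    ((\<integral>\<^sup>+ (z, w). ennreal (1 + g w) * f (1, z, w) \<partial>R) +
     (\<integral>\<^sup>+ (z, w). ennreal (1 - g w) * f (-1, z, w) \<partial>R)) / 2"
proof -
  have "(\<integral>\<^sup>+ x. f x \<partial>binary_response_law R g) =
     (\<integral>\<^sup>+ x. (\<lambda>(y, z, w). ennreal (1 + y * g w)) x * f x \<partial>(coin \<Otimes>\<^sub>M R))"
    unfolding binary_response_law_def
    by (intro nn_integral_density measurable_on_coin_pair density_coin_pair_measurable f)
  also have "\<dots> = ((\<integral>\<^sup>+ (z, w). ennreal (1 + g w) * f (1, z, w) \<partial>R) +
     (\<integral>\<^sup>+ (z, w). ennreal (1 - g w) * f (-1, z, w) \<partial>R)) / 2"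
    by (subst nn_integral_coin_pair) (auto intro!: borel_measurable_times_ennreal f)
  finally show ?thesis .
qed

lemma integral_binary_response_law:
  fixes f :: "real \<times> real \<times> real \<Rightarrow> real"
  assumes f: "f \<in> borel_measurable borel" and int: "integrable (binary_response_law R g) f"
  shows "(\<integral> x. f x \<partial>binary_response_law R g) =
    ((\<integral> (z, w). (1 + g w) * f (1, z, w) \<partial>R) + (\<integral> (z, w). (1 - g w) * f (-1, z, w) \<partial>R)) / 2"
proof -
  interpret pair_prob_space coin R by (rule pair_prob_space_coin)
  note f' [measurable] = measurable_on_coin_pair[OF f]
  define L where "L = (\<lambda>(y :: real, z :: real, w). 1 + y * g w)"
  have law: "binary_response_law R g = density (coin \<Otimes>\<^sub>M R) (\<lambda>x. ennreal (L x))"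
    unfolding binary_response_law_def L_def by (simp add: case_prod_unfold)
  have L [measurable]: "L \<in> borel_measurable (coin \<Otimes>\<^sub>M R)"
    unfolding L_def by measurable
  have L0: "AE x in coin \<Otimes>\<^sub>M R. 0 \<le> L x"
  proof (rule AE_pair_measure)
    show "AE y in coin. AE v in R. 0 \<le> L (y, v)"
      using AE_coin
    proof eventually_elim
      case (elim y)
      have "\<bar>y * g w\<bar> \<le> 1" for w
        using mult_mono[OF elim g_le[of w]] by (simp add: abs_mult)
      then have "0 \<le> 1 + y * g w" for w
        by (smt (verit))
      then have "0 \<le> L (y, v)" for v
        by (cases v) (auto simp: L_def)
      then show ?case by simp
    qed
  qed measurable
  have "integrable (coin \<Otimes>\<^sub>M R) (\<lambda>x. L x * f x)"
    using int L0 unfolding law by (subst (asm) integrable_density) auto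
  from integral_fst'[OF this]
  have "(\<integral> x. f x \<partial>binary_response_law R g) = (\<integral> y. \<integral> v. L (y, v) * f (y, v) \<partial>R \<partial>coin)"
    using L0 unfolding law by (subst integral_density) auto
  also have "\<dots> = ((\<integral> v. L (-1, v) * f (-1, v) \<partial>R) + (\<integral> v. L (1, v) * f (1, v) \<partial>R)) / 2"
    by (rule integral_coin) measurable
  finally show ?thesis
    by (simp add: L_def add.commute case_prod_unfold)
qed

lemma AE_binary_response_law: "AE x in binary_response_law R g. \<bar>fst x\<bar> \<le> 1"
proof -
  interpret pair_prob_space coin R by (rule pair_prob_space_coin)
  have "AE x in coin \<Otimes>\<^sub>M R. \<bar>fst x\<bar> \<le> 1"
  proof (rule AE_pair_measure)
    show "{x \<in> space (coin \<Otimes>\<^sub>M R). \<bar>fst x\<bar> \<le> 1} \<in> sets (coin \<Otimes>\<^sub>M R)"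
      by measurable
  qed (use AE_coin in auto)
  then show ?thesis
    unfolding binary_response_law_def
    by (subst AE_density) (auto intro!: measurable_on_coin_pair)
qed

lemma prob_space_binary_response_law: "prob_space (binary_response_law R g)"
proof (rule prob_spaceI)
  interpret R: prob_space R by (rule R)
  have "emeasure (binary_response_law R g) (space (binary_response_law R g)) = (\<integral>\<^sup>+ x. 1 \<partial>binary_response_law R g)"
    by simp
  also have "\<dots> = ((\<integral>\<^sup>+ (z, w). ennreal (1 + g w) \<partial>R) + (\<integral>\<^sup>+ (z, w). ennreal (1 - g w) \<partial>R)) / 2"
    by (subst nn_integral_binary_response_law) auto
  also have "\<dots> = (\<integral>\<^sup>+ (z, w). ennreal (1 + g w) + ennreal (1 - g w) \<partial>R) / 2"
    by (subst nn_integral_add[symmetric]) (auto simp: case_prod_unfold)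
  also have "(\<lambda>(z :: real, w). ennreal (1 + g w) + ennreal (1 - g w)) = (\<lambda>_. 2)"
    using response_weights_sum by (auto simp: fun_eq_iff)
  finally show "emeasure (binary_response_law R g) (space (binary_response_law R g)) = 1"
    by (simp add: R.emeasure_space_1 ennreal_divide_self)
qed

lemma distr_snd_binary_response_law: "distr (binary_response_law R g) borel snd = R"
proof (rule measure_eqI)
  show "sets (distr (binary_response_law R g) borel snd) = sets R"
    by (simp add: sets_R)
  fix A assume "A \<in> sets (distr (binary_response_law R g) borel snd)"
  then have A: "A \<in> sets borel" "A \<in> sets R" by (auto simp: sets_R)
  have snd: "snd \<in> borel_measurable (borel :: (real \<times> real \<times> real) measure)"
      by measurable
  have "emeasure (distr (binary_response_law R g) borel snd) A
      = (\<integral>\<^sup>+ x. indicator A x \<partial>distr (binary_response_law R g) borel snd)"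
    using A by simp
  also have "\<dots> = (\<integral>\<^sup>+ x. indicator A (snd x) \<partial>binary_response_law R g)"
    using A snd by (intro nn_integral_distr)
      (auto simp: measurable_cong_sets[OF sets_binary_response_law refl])
  also have "\<dots> = ((\<integral>\<^sup>+ (z, w). ennreal (1 + g w) * indicator A (z, w) \<partial>R) +
      (\<integral>\<^sup>+ (z, w). ennreal (1 - g w) * indicator A (z, w) \<partial>R)) / 2"
    using A snd by (subst nn_integral_binary_response_law) (auto intro!: measurable_compose[OF snd])
  also have "\<dots> = (\<integral>\<^sup>+ (z, w). ennreal (1 + g w) * indicator A (z, w) + ennreal (1 - g w) * indicator A (z, w) \<partial>R) / 2"
    using A(2) by (subst nn_integral_add[symmetric]) (auto simp: case_prod_unfold)
  also have "(\<lambda>(z, w). ennreal (1 + g w) * indicator A (z, w) + ennreal (1 - g w) * indicator A (z, w)) = (\<lambda>x. 2 * indicator A x)"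
    using response_weights_sum by (auto simp: fun_eq_iff simp flip: distrib_right)
  also have "(\<integral>\<^sup>+ x. 2 * indicator A x \<partial>R) / 2 = emeasure R A"
    using A(2) ennreal_mult_divide_eq[of 2 "emeasure R A"]
    by (subst nn_integral_cmult) (auto simp: mult.commute)
  finally show "emeasure (distr (binary_response_law R g) borel snd) A = emeasure R A" .
qed

lemma integrable_binary_response_law_bounded:
  fixes f :: "real \<times> real \<times> real \<Rightarrow> real"
  assumes "f \<in> borel_measurable borel" "\<And>y z w. \<bar>y\<bar> \<le> 1 \<Longrightarrow> \<bar>f (y, z, w)\<bar> \<le> B"
  shows "integrable (binary_response_law R g) f"
proof -
  interpret prob_space "binary_response_law R g" by (rule prob_space_binary_response_law)
  show ?thesis
  proof (rule integrable_const_bound)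
    show "AE x in binary_response_law R g. norm (f x) \<le> B"
      using AE_binary_response_law by eventually_elim (use assms(2) in auto)
    show "f \<in> borel_measurable (binary_response_law R g)"
      using assms(1) by (simp add: measurable_cong_sets[OF sets_binary_response_law refl])
  qed
qed

text \<open>
  The observations determine the structural function only through the conditional mean of the
  response given \<open>W\<close>. If \<open>g(W)\<close> is the conditional expectation of \<open>\<phi>(Z)\<close>, which is what \<open>orth\<close> says,
  the binary response is a legitimate response for \<open>\<phi>\<close>: its error \<open>Y - \<phi>(Z)\<close> is centred
  given \<open>W\<close> and bounded by \<open>2\<close>, whence the threshold for \<open>\<sigma>\<close>.
\<close>

lemma binary_response_error_in_error_class:
  fixes Z W :: "'m \<Rightarrow> real"
  assumes R_eq: "R = distr M borel (\<lambda>\<omega>. (Z \<omega>, W \<omega>))"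
    and \<phi> [measurable]: "\<phi> \<in> borel_measurable borel" and \<phi>_le: "\<And>z. \<bar>\<phi> z\<bar> \<le> 1"
    and orth: "\<And>B. B \<in> sets borel \<Longrightarrow> (\<integral> (z, w). indicator B w * (g w - \<phi> z) \<partial>R) = 0"
    and \<sigma>: "2 \<le> \<sigma>"
  shows "distr (binary_response_law R g) borel (\<lambda>(y, z, w). (y - \<phi> z, z, w)) \<in> error_class M Z W \<sigma>"
proof -
  define e :: "real \<times> real \<times> real \<Rightarrow> real \<times> real \<times> real" where "e = (\<lambda>(y, z, w). (y - \<phi> z, z, w))"
  define P where "P = binary_response_law R g"
  define Q where "Q = distr P borel e"
  define U W' :: "real \<times> real \<times> real \<Rightarrow> real" where "U = (\<lambda>(u, z, w). u)" and "W' = (\<lambda>(u, z, w). w)"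
  define F where "F = sigma_gen Q W'"
  interpret R: prob_space R by (rule R)
  interpret P: prob_space P unfolding P_def by (rule prob_space_binary_response_law)
  have sets_P [measurable_cong]: "sets P = sets borel"
    unfolding P_def by (rule sets_binary_response_law)
  have sets_Q [measurable_cong]: "sets Q = sets borel" and space_Q: "space Q = UNIV"
    by (simp_all add: Q_def)
  have e [measurable]: "e \<in> borel \<rightarrow>\<^sub>M borel"
    unfolding e_def by measurable
  have U [measurable]: "U \<in> borel_measurable borel" and W' [measurable]: "W' \<in> borel_measurable borel"
    unfolding U_def W'_def by measurable
  have e_P [measurable]: "e \<in> P \<rightarrow>\<^sub>M borel" by measurable
  interpret Q: prob_space Q
    unfolding Q_def by (rule P.prob_space_distr) measurable
  have F_sets: "sets F = {W' -` B \<inter> space Q | B. B \<in> sets borel}"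
    unfolding F_def by (rule sets_vimage_algebra2) auto
  interpret F: finite_measure_subalgebra Q F
  proof
    have "W' -` B \<inter> space Q \<in> sets Q" if "B \<in> sets borel" for B
      using that by measurable
    then show "subalgebra Q F"
      unfolding subalgebra_def F_sets by (auto simp: F_def)
  qed
  have U_le: "AE x in Q. \<bar>U x\<bar> \<le> 2"
  proof -
    have "AE x in P. \<bar>U (e x)\<bar> \<le> 2"
      unfolding P_def using AE_binary_response_law
    proof eventually_elim
      case (elim x)
      then show ?case
        using \<phi>_le[of "fst (snd x)"] by (cases x) (auto simp: U_def e_def)
    qed
    then show ?thesis
      unfolding Q_def by (subst AE_distr_iff) auto
  qed
  have U_int: "integrable Q U"
    by (rule Q.integrable_const_bound[of _ 2]) (use U_le in auto)
  have distr: "distr Q borel snd = distr M borel (\<lambda>\<omega>. (Z \<omega>, W \<omega>))"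
  proof -
    have "distr Q borel snd = distr P borel (snd \<circ> e)"
      unfolding Q_def by (rule distr_distr) measurable
    also have "snd \<circ> e = snd"
      by (auto simp: e_def fun_eq_iff)
    finally show ?thesis
      by (simp add: P_def distr_snd_binary_response_law flip: R_eq)
  qed
  have mean: "AE x in Q. real_cond_exp Q F U x = 0"
  proof (rule F.real_cond_exp_charact)
    fix A assume "A \<in> sets F"
    then obtain B where B [measurable]: "B \<in> sets borel" and A: "A = W' -` B \<inter> space Q"
      unfolding F_sets by auto
    let ?f = "\<lambda>x. indicator B (W' (e x)) * U (e x)"
    have int_R: "integrable R (\<lambda>(z, w). indicator B w * f z w)"
      if [measurable]: "(\<lambda>v. f (fst v) (snd v)) \<in> borel_measurable (borel \<Otimes>\<^sub>M borel)"
        and le: "\<And>z w. \<bar>f z w\<bar> \<le> C" for f :: "real \<Rightarrow> real \<Rightarrow> real" and C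
    proof (rule R.integrable_const_bound[of _ C])
      have "0 \<le> C" using le[of 0 0] by simp
      then show "AE x in R. norm (case x of (z, w) \<Rightarrow> indicator B w * f z w) \<le> C"
        using le by (auto simp: indicator_def)
      show "(\<lambda>(z, w). indicator B w * f z w) \<in> borel_measurable R"
        unfolding case_prod_unfold by measurable
    qed
    have "(\<integral>x\<in>A. U x \<partial>Q) = (\<integral>x. indicator B (W' x) * U x \<partial>Q)"
      unfolding set_lebesgue_integral_def A
      by (intro Bochner_Integration.integral_cong) (auto simp: space_Q indicator_def)
    also have "\<dots> = (\<integral>x. ?f x \<partial>P)"
      unfolding Q_def by (subst integral_distr) auto
    also have "\<dots> = ((\<integral> (z, w). (1 + g w) * ?f (1, z, w) \<partial>R) + (\<integral> (z, w). (1 - g w) * ?f (-1, z, w) \<partial>R)) / 2"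
      unfolding P_def
    proof (rule integral_binary_response_law)
      show "integrable (binary_response_law R g) ?f"
      proof (rule integrable_binary_response_law_bounded[of _ 2])
        fix y z w :: real assume "\<bar>y\<bar> \<le> 1"
        then show "\<bar>?f (y, z, w)\<bar> \<le> 2"
          using \<phi>_le[of z] by (auto simp: U_def e_def indicator_def)
      qed measurable
    qed measurable
    \<comment> \<open>Averaging the two values of the response leaves the integrand of \<open>orth\<close>.\<close>
    also have "\<dots> = ((\<integral> (z, w). indicator B w * ((1 + g w) * (1 - \<phi> z)) \<partial>R) +
        (\<integral> (z, w). indicator B w * ((1 - g w) * (-1 - \<phi> z)) \<partial>R)) / 2"
      by (simp add: U_def W'_def e_def mult_ac)
    also have "\<dots> = (\<integral> (z, w). indicator B w * ((1 + g w) * (1 - \<phi> z)) +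
        indicator B w * ((1 - g w) * (-1 - \<phi> z)) \<partial>R) / 2"
    proof -
      have "\<bar>(1 + g w) * (1 - \<phi> z)\<bar> \<le> 2 * 2" "\<bar>(1 - g w) * (-1 - \<phi> z)\<bar> \<le> 2 * 2" for z w
        unfolding abs_mult using g_le[of w] \<phi>_le[of z] by (intro mult_mono; simp add: abs_le_iff)+
      then show ?thesis
        by (subst Bochner_Integration.integral_add[symmetric]) (auto simp: case_prod_unfold
          intro!: int_R[unfolded case_prod_unfold, of _ "2 * 2"])
    qed
    also have "\<dots> = (\<integral> (z, w). 2 * (indicator B w * (g w - \<phi> z)) \<partial>R) / 2"
      by (intro arg_cong[where f = "\<lambda>x. x / 2"] Bochner_Integration.integral_cong) (auto simp: algebra_simps)
    also have "\<dots> = (\<integral> (z, w). indicator B w * (g w - \<phi> z) \<partial>R)"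
      by (simp add: case_prod_unfold)
    finally show "(\<integral>x\<in>A. U x \<partial>Q) = (\<integral>x\<in>A. 0 \<partial>Q)"
      using orth[OF B] by (simp add: set_lebesgue_integral_def)
  qed (auto intro: U_int)
  have moment: "AE x in Q. nn_cond_exp Q F (\<lambda>x. ennreal (U x ^ 4)) x \<le> ennreal (\<sigma> ^ 4)"
  proof -
    have "AE x in Q. nn_cond_exp Q F (\<lambda>x. ennreal (U x ^ 4)) x \<le> nn_cond_exp Q F (\<lambda>x. ennreal (\<sigma> ^ 4)) x"
    proof (rule F.nn_cond_exp_mono)
      show "AE x in Q. ennreal (U x ^ 4) \<le> ennreal (\<sigma> ^ 4)"
        using U_le
      proof eventually_elim
        case (elim x)
        then have "\<bar>U x\<bar> ^ 4 \<le> \<sigma> ^ 4"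
          using \<sigma> by (intro power_mono) auto
        then show ?case by (simp add: ennreal_leI)
      qed
    qed measurable
    moreover have "AE x in Q. ennreal (\<sigma> ^ 4) = nn_cond_exp Q F (\<lambda>x. ennreal (\<sigma> ^ 4)) x"
      by (rule F.nn_cond_exp_F_meas) measurable
    ultimately show ?thesis
      by eventually_elim simp
  qed
  have "Q \<in> error_class M Z W \<sigma>"
    using Q.prob_space_axioms sets_Q distr U_int mean moment
    unfolding error_class_def U_def W'_def F_def by (simp add: case_prod_unfold)
  then show ?thesis
    by (simp add: Q_def P_def e_def)
qed

lemma observation_law_binary_response:
  assumes [measurable]: "\<phi> \<in> borel_measurable borel"
  shows "observation_law (distr (binary_response_law R g) borel (\<lambda>(y, z, w). (y - \<phi> z, z, w))) \<phi>
    = binary_response_law R g"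
proof -
  have m: "(\<lambda>(y, z, w). (y - \<phi> z, z, w :: real)) \<in> binary_response_law R g \<rightarrow>\<^sub>M borel"
    unfolding measurable_cong_sets[OF sets_binary_response_law refl] by measurable
  have "observation_law (distr (binary_response_law R g) borel (\<lambda>(y, z, w). (y - \<phi> z, z, w))) \<phi>
    = distr (binary_response_law R g) borel ((\<lambda>(u, z, w). (\<phi> z + u, z, w)) \<circ> (\<lambda>(y, z, w). (y - \<phi> z, z, w)))"
    unfolding observation_law_def by (intro distr_distr m) measurable
  also have "(\<lambda>(u, z, w). (\<phi> z + u, z, w)) \<circ> (\<lambda>(y, z, w). (y - \<phi> z, z, w)) = (\<lambda>x. x :: real \<times> real \<times> real)"
    by (auto simp: fun_eq_iff)
  finally show ?thesis
    by (simp add: distr_id2 sets_binary_response_law)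
qed

text \<open>
  The fair coin is the null model \<open>g = 0\<close>. The terms linear in \<open>g\<close> cancel between the two values of the
  coin, and the \<open>\<chi>\<^sup>2\<close>-divergence is the squared norm of \<open>g\<close> alone.
\<close>

lemma chi_square_binary_response_law:
  "(\<integral>\<^sup>+ (y, z, w). ennreal ((1 + y * g w)\<^sup>2) \<partial>(coin \<Otimes>\<^sub>M R)) = 1 + (\<integral>\<^sup>+ (z, w). ennreal ((g w)\<^sup>2) \<partial>R)"
proof -
  interpret R: prob_space R by (rule R)
  have "(\<integral>\<^sup>+ (y, z, w). ennreal ((1 + y * g w)\<^sup>2) \<partial>(coin \<Otimes>\<^sub>M R)) =
    ((\<integral>\<^sup>+ (z, w). ennreal ((1 + g w)\<^sup>2) \<partial>R) + (\<integral>\<^sup>+ (z, w). ennreal ((1 - g w)\<^sup>2) \<partial>R)) / 2"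
    by (subst nn_integral_coin_pair) simp_all
  also have "\<dots> = (\<integral>\<^sup>+ (z, w). ennreal ((1 + g w)\<^sup>2) + ennreal ((1 - g w)\<^sup>2) \<partial>R) / 2"
    by (subst nn_integral_add[symmetric]) (auto simp: case_prod_unfold)
  also have "\<dots> = (\<integral>\<^sup>+ (z, w). (1 + ennreal ((g w)\<^sup>2)) * 2 \<partial>R) / 2"
  proof -
    have "ennreal ((1 + x)\<^sup>2) + ennreal ((1 - x)\<^sup>2) = (1 + ennreal (x\<^sup>2)) * 2" for x :: real
    proof -
      have "ennreal ((1 + x)\<^sup>2) + ennreal ((1 - x)\<^sup>2) = ennreal ((1 + x)\<^sup>2 + (1 - x)\<^sup>2)"
        by (rule ennreal_plus[symmetric]) auto
      also have "(1 + x)\<^sup>2 + (1 - x)\<^sup>2 = (1 + x\<^sup>2) * 2"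
        by (simp add: power2_eq_square algebra_simps)
      also have "ennreal ((1 + x\<^sup>2) * 2) = ennreal (1 + x\<^sup>2) * ennreal 2"
        by (rule ennreal_mult) auto
      also have "ennreal (1 + x\<^sup>2) = 1 + ennreal (x\<^sup>2)"
        by (subst ennreal_plus) auto
      finally show ?thesis by simp
    qed
    then show ?thesis by simp
  qed
  also have "\<dots> = (1 + (\<integral>\<^sup>+ (z, w). ennreal ((g w)\<^sup>2) \<partial>R)) * 2 / 2"
    by (simp add: case_prod_unfold nn_integral_multc nn_integral_add R.emeasure_space_1)
  also have "\<dots> = 1 + (\<integral>\<^sup>+ (z, w). ennreal ((g w)\<^sup>2) \<partial>R)"
    by (rule ennreal_mult_divide_eq) auto
  finally show ?thesis .
qed

end

section \<open>Lower bounds on the maximal risk\<close>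

text \<open>
  The comparison of \<open>\<phi>\<close> with the zero function for one fixed representer \<open>h\<close>. Both are fitted with a
  binary response, whose conditional means given \<open>W\<close> are \<open>T \<phi>\<close> and \<open>0\<close>; the
  \<open>\<chi>\<^sup>2\<close>-divergence of one observation is then at most the squared norm of \<open>T \<phi>\<close>.
\<close>

lemma max_risk_two_point:
  fixes M :: "'m measure" and Z W :: "'m \<Rightarrow> real"
  assumes M: "prob_space M"
    and Z [measurable]: "Z \<in> borel_measurable M" and W [measurable]: "W \<in> borel_measurable M"
    and W_unif: "distr M borel W = unit_unif"
    and \<phi> [measurable]: "\<phi> \<in> borel_measurable borel" and \<phi>_le: "\<And>z. \<bar>\<phi> z\<bar> \<le> 1"
    and \<Phi>: "\<phi> \<in> \<Phi>" "(\<lambda>_. 0) \<in> \<Phi>" and h: "h \<in> H" "h \<in> L2_unit"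
    and T: "cond_exp_op M Z W \<phi> \<in> L2_unit"
    and K: "real n * (l2_norm (cond_exp_op M Z W \<phi>))\<^sup>2 \<le> K"
    and \<sigma>: "2 \<le> \<sigma>" and est: "est \<in> estimators n"
  shows "ennreal ((target M Z h \<phi>)\<^sup>2 / (2 * (1 + exp K))) \<le> max_risk M Z W \<sigma> \<Phi> H n est"
proof -
  interpret M: prob_space M by (rule M)
  define R where "R = distr M borel (\<lambda>\<omega>. (Z \<omega>, W \<omega>))"
  define g where "g = cond_exp_op M Z W \<phi>"
  \<comment> \<open>The chosen version of the conditional expectation is bounded by \<open>1\<close> almost everywhere only;
    a binary response needs the bound everywhere.\<close>
  define g' where "g' w = (if \<bar>g w\<bar> \<le> 1 then g w else 0)" for w
  define F where "F = sigma_gen M W"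
  have ZW [measurable]: "(\<lambda>\<omega>. (Z \<omega>, W \<omega>)) \<in> M \<rightarrow>\<^sub>M borel"
    by (simp add: borel_measurable_Pair)
  have R: "prob_space R" unfolding R_def by (rule M.prob_space_distr) measurable
  have sets_R: "sets R = sets borel" by (simp add: R_def)
  have g [measurable]: "g \<in> borel_measurable borel"
    and g_AE: "AE \<omega> in M. g (W \<omega>) = real_cond_exp M F (\<lambda>\<omega>. \<phi> (Z \<omega>)) \<omega>"
    using cond_exp_op_version[of M Z W \<phi>] by (simp_all add: g_def F_def)
  have g' [measurable]: "g' \<in> borel_measurable borel"
    unfolding g'_def[abs_def] by measurable
  have g'_le: "\<bar>g' w\<bar> \<le> 1" for w by (simp add: g'_def)
  have F_sets: "sets F = {W -` B \<inter> space M | B. B \<in> sets borel}"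
    unfolding F_def by (rule sets_vimage_algebra2) auto
  interpret F: finite_measure_subalgebra M F
  proof
    show "subalgebra M F"
      unfolding subalgebra_def F_sets using measurable_sets[OF W] by (auto simp: F_def)
  qed
  have \<phi>_int: "integrable M (\<lambda>\<omega>. \<phi> (Z \<omega>))"
    by (rule M.integrable_const_bound[of _ 1]) (use \<phi>_le in auto)
  have g'_AE: "AE \<omega> in M. g' (W \<omega>) = real_cond_exp M F (\<lambda>\<omega>. \<phi> (Z \<omega>)) \<omega>"
  proof -
    have "AE \<omega> in M. real_cond_exp M F (\<lambda>\<omega>. \<phi> (Z \<omega>)) \<omega> \<le> 1"
      using \<phi>_le by (intro F.real_cond_exp_le_c \<phi>_int) (auto simp: abs_le_iff)
    moreover have "AE \<omega> in M. -1 \<le> real_cond_exp M F (\<lambda>\<omega>. \<phi> (Z \<omega>)) \<omega>"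
      using \<phi>_le by (intro F.real_cond_exp_ge_c \<phi>_int) (auto simp: abs_le_iff minus_le_iff)
    ultimately show ?thesis
      using g_AE by eventually_elim (auto simp: g'_def)
  qed
  have orth: "(\<integral> (z, w). indicator B w * (g' w - \<phi> z) \<partial>R) = 0" if B [measurable]: "B \<in> sets borel" for B
  proof -
    let ?A = "W -` B \<inter> space M"
    have A: "?A \<in> sets F" using B by (auto simp: F_sets)
    then have A_M: "?A \<in> sets M" using measurable_sets[OF W B] by simp
    have int: "integrable M (\<lambda>\<omega>. indicator ?A \<omega> * f \<omega>)"
      if "f \<in> borel_measurable M" "\<And>\<omega>. \<bar>f \<omega>\<bar> \<le> 1" for f :: "'m \<Rightarrow> real"
      using that A_M by (intro M.integrable_const_bound[of _ 1]) (auto simp: indicator_def)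
    have meas: "(\<lambda>(z, w). indicator B w * (g' w - \<phi> z)) \<in> borel_measurable borel"
      unfolding borel_prod[symmetric] by measurable
    have "(\<integral> (z, w). indicator B w * (g' w - \<phi> z) \<partial>R) = (\<integral> \<omega>. indicator B (W \<omega>) * (g' (W \<omega>) - \<phi> (Z \<omega>)) \<partial>M)"
      unfolding R_def using integral_distr[OF ZW meas] by (simp add: case_prod_unfold)
    also have "\<dots> = (\<integral> \<omega>. indicator ?A \<omega> * g' (W \<omega>) - indicator ?A \<omega> * \<phi> (Z \<omega>) \<partial>M)"
      by (intro Bochner_Integration.integral_cong) (auto simp: indicator_def)
    also have "\<dots> = (\<integral> \<omega>. indicator ?A \<omega> * g' (W \<omega>) \<partial>M) - (\<integral> \<omega>. indicator ?A \<omega> * \<phi> (Z \<omega>) \<partial>M)"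
      using g'_le \<phi>_le by (intro Bochner_Integration.integral_diff int) auto
    also have "(\<integral> \<omega>. indicator ?A \<omega> * g' (W \<omega>) \<partial>M) =
        (\<integral> \<omega>. indicator ?A \<omega> * real_cond_exp M F (\<lambda>\<omega>. \<phi> (Z \<omega>)) \<omega> \<partial>M)"
      using A_M g'_AE by (intro integral_cong_AE) auto
    also have "\<dots> = (\<integral> \<omega>. indicator ?A \<omega> * \<phi> (Z \<omega>) \<partial>M)"
      using F.real_cond_exp_intA[OF \<phi>_int A] by (simp add: set_lebesgue_integral_def)
    finally show ?thesis by simp
  qed
  define P0 P1 where "P0 = binary_response_law R (\<lambda>_. 0)" and "P1 = binary_response_law R g'"
  define Q0 Q1 where "Q0 = distr P0 borel (\<lambda>(y, z, w). (y - 0, z, w))"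
    and "Q1 = distr P1 borel (\<lambda>(y, z, w). (y - \<phi> z, z, w))"
  have Q0: "Q0 \<in> error_class M Z W \<sigma>"
    unfolding Q0_def P0_def
    by (rule binary_response_error_in_error_class[OF R sets_R]) (use R_def \<sigma> in \<open>auto simp: case_prod_unfold\<close>)
  have Q1: "Q1 \<in> error_class M Z W \<sigma>"
    unfolding Q1_def P1_def
    by (rule binary_response_error_in_error_class[OF R sets_R g' g'_le R_def \<phi> \<phi>_le orth \<sigma>])
  have sample0: "sample_law n Q0 (\<lambda>_. 0) = PiM {1..n} (\<lambda>_. P0)"
    unfolding sample_law_def Q0_def P0_def
    by (subst observation_law_binary_response[OF R sets_R]) auto
  have sample1: "sample_law n Q1 \<phi> = PiM {1..n} (\<lambda>_. P1)"
    unfolding sample_law_def Q1_def P1_def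
    by (subst observation_law_binary_response[OF R sets_R]) (use g'_le in auto)
  have P0: "P0 = coin \<Otimes>\<^sub>M R"
    by (simp add: P0_def binary_response_law_def case_prod_unfold density_1)
  have sets_P0: "sets P0 = sets borel"
    unfolding P0_def by (rule sets_binary_response_law[OF R sets_R]) auto
  \<comment> \<open>Truncation at \<open>0\<close> only affects values of \<open>y\<close> outside the support of the coin.\<close>
  define L where "L = (\<lambda>(y, z :: real, w). max 0 (1 + y * g' w))"
  have L_eq: "(\<lambda>x. ennreal (L x)) = (\<lambda>(y, z, w). ennreal (1 + y * g' w))"
    by (auto simp: L_def fun_eq_iff max_def ennreal_neg)
  have P1: "P1 = density P0 (\<lambda>x. ennreal (L x))"
    by (simp add: P1_def P0 L_eq binary_response_law_def)
  have L [measurable]: "L \<in> borel_measurable borel"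
    unfolding L_def borel_prod[symmetric] by measurable
  have L_P0: "L \<in> borel_measurable P0"
    using L by (simp add: measurable_cong_sets[OF sets_P0 refl])
  define \<delta> where "\<delta> = (l2_norm g)\<^sup>2"
  have "0 \<le> \<delta>" by (simp add: \<delta>_def)
  have norm: "(\<integral>\<^sup>+ (z, w). ennreal ((g' w)\<^sup>2) \<partial>R) \<le> ennreal \<delta>"
  proof -
    have meas: "(\<lambda>(z :: real, w). ennreal ((g' w)\<^sup>2)) \<in> borel_measurable borel"
      unfolding borel_prod[symmetric] by measurable
    have "(\<integral>\<^sup>+ (z, w). ennreal ((g' w)\<^sup>2) \<partial>R) = (\<integral>\<^sup>+ \<omega>. ennreal ((g' (W \<omega>))\<^sup>2) \<partial>M)"
      unfolding R_def using nn_integral_distr[OF ZW] meas by (simp add: case_prod_unfold)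
    also have "\<dots> \<le> (\<integral>\<^sup>+ \<omega>. ennreal ((g (W \<omega>))\<^sup>2) \<partial>M)"
      by (intro nn_integral_mono ennreal_leI) (auto simp: g'_def)
    also have "\<dots> = (\<integral>\<^sup>+ w. ennreal ((g w)\<^sup>2) \<partial>unit_unif)"
      unfolding W_unif[symmetric] by (subst nn_integral_distr) auto
    also have "\<dots> = ennreal (LINT w|unit_unif. (g w)\<^sup>2)"
      using T by (intro nn_integral_eq_integral) (auto simp: L2_unit_def g_def)
    also have "(LINT w|unit_unif. (g w)\<^sup>2) = \<delta>"
      by (simp add: \<delta>_def l2_norm_def l2_inner_def power2_eq_square)
    finally show ?thesis .
  qed
  have L1: "(\<integral>\<^sup>+ x. ennreal (L x) \<partial>P0) = 1"
  proof -
    interpret P1: prob_space P1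
      unfolding P1_def by (rule prob_space_binary_response_law[OF R sets_R g' g'_le])
    show ?thesis
      using P1.emeasure_space_1 L_P0 unfolding P1
      by (simp add: emeasure_density cong: nn_integral_cong)
  qed
  have L2: "(\<integral>\<^sup>+ x. ennreal ((L x)\<^sup>2) \<partial>P0) \<le> ennreal (1 + \<delta>)"
  proof -
    have "(\<integral>\<^sup>+ x. ennreal ((L x)\<^sup>2) \<partial>P0) \<le> (\<integral>\<^sup>+ (y, z, w). ennreal ((1 + y * g' w)\<^sup>2) \<partial>(coin \<Otimes>\<^sub>M R))"
      unfolding P0 by (intro nn_integral_mono) (auto simp: L_def max_def)
    also have "\<dots> = 1 + (\<integral>\<^sup>+ (z, w). ennreal ((g' w)\<^sup>2) \<partial>R)"
      by (rule chi_square_binary_response_law[OF R sets_R g' g'_le])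
    also have "\<dots> \<le> 1 + ennreal \<delta>"
      by (intro add_left_mono norm)
    finally show ?thesis using \<open>0 \<le> \<delta>\<close> by simp
  qed
  let ?\<Delta> = "target M Z h \<phi>" and ?m = "max_risk M Z W \<sigma> \<Phi> H n est"
  have e: "est h \<in> borel_measurable (PiM {1..n} (\<lambda>_. P0))"
    using est h(2) unfolding estimators_def
    by (simp add: measurable_cong_sets[OF sets_PiM_cong[OF refl sets_P0] refl])
  have "ennreal (?\<Delta>\<^sup>2 / (1 + exp K)) \<le>
     (\<integral>\<^sup>+ x. ennreal (\<bar>est h x\<bar>\<^sup>2) \<partial>PiM {1..n} (\<lambda>_. P0)) +
     (\<integral>\<^sup>+ x. ennreal (\<bar>est h x - ?\<Delta>\<bar>\<^sup>2) \<partial>PiM {1..n} (\<lambda>_. P1))"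
    unfolding P1
  proof (rule chi_square_two_point_bound_product[OF _ _ L_P0 _ L1 L2 \<open>0 \<le> \<delta>\<close> _ e])
    show "prob_space P0"
      unfolding P0_def by (rule prob_space_binary_response_law[OF R sets_R]) auto
    show "real (card {1..n}) * \<delta> \<le> K"
      using K by (simp add: \<delta>_def g_def)
  qed (auto simp: L_def)
  also have "\<dots> = (\<integral>\<^sup>+ x. ennreal (\<bar>est h x - target M Z h (\<lambda>_. 0)\<bar>\<^sup>2) \<partial>sample_law n Q0 (\<lambda>_. 0)) +
     (\<integral>\<^sup>+ x. ennreal (\<bar>est h x - ?\<Delta>\<bar>\<^sup>2) \<partial>sample_law n Q1 \<phi>)"
    by (simp add: sample0 sample1 target_def)
  also have "\<dots> \<le> ?m + ?m"
    unfolding max_risk_def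
    by (intro add_mono SUP_upper2[OF Q0] SUP_upper2[OF Q1] SUP_upper2[OF \<Phi>(1)] SUP_upper2[OF \<Phi>(2)] SUP_upper2[OF h(1)] order_refl)
  finally have two: "ennreal (?\<Delta>\<^sup>2 / (1 + exp K)) \<le> 2 * ?m"
    by (simp add: mult_2)
  have "?\<Delta>\<^sup>2 / (2 * (1 + exp K)) = ?\<Delta>\<^sup>2 / (1 + exp K) / 2"
    by (metis divide_divide_eq_left mult.commute)
  also have "ennreal \<dots> = ennreal (?\<Delta>\<^sup>2 / (1 + exp K)) / ennreal 2"
    by (intro divide_ennreal[symmetric]) (auto simp: add_pos_pos divide_nonneg_pos)
  also have "ennreal 2 = 2" by simp
  also have "ennreal (?\<Delta>\<^sup>2 / (1 + exp K)) / 2 \<le> (2 * ?m) / 2"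
    by (rule divide_right_mono_ennreal[OF two])
  also have "\<dots> = ?m"
    using ennreal_mult_divide_eq[of 2 ?m] by (simp add: mult.commute)
  finally show ?thesis .
qed

text \<open>
  The alternative is a multiple of the single basis function \<open>e\<^sub>j\<close>, and the representer is the largest
  multiple of \<open>e\<^sub>j\<close> in its ellipsoid. The upper bound in the link condition turns the squared norm
  of \<open>T \<phi>\<close> into \<open>d v\<^sub>j \<theta>\<^sup>2\<close>. The amplitude satisfies \<open>\<theta>\<^sup>2 \<le> 1 / 2\<close> because \<open>e\<^sub>j\<close> takes
  values of modulus up to \<open>sqrt 2\<close> and \<open>\<phi>\<close> has to be bounded by \<open>1\<close>.
\<close>

lemma max_risk_trig_basis:
  fixes M :: "'m measure" and Z W :: "'m \<Rightarrow> real" and p s \<rho> \<tau> d \<theta> K \<sigma> :: real and v :: "nat \<Rightarrow> real"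
  assumes M: "prob_space M"
    and Z [measurable]: "Z \<in> borel_measurable M" and W [measurable]: "W \<in> borel_measurable M"
    and Z_unif: "distr M borel Z = unit_unif" and W_unif: "distr M borel W = unit_unif"
    and pos: "0 < \<rho>" "0 < \<tau>" "1 \<le> d"
    and T: "cond_exp_op M Z W \<in> link_class v d"
    and j: "1 \<le> j" and v: "0 \<le> v j"
    and \<theta>: "\<theta>\<^sup>2 \<le> 1 / 2" "\<theta>\<^sup>2 * real j powr (2 * p) \<le> \<rho>"
    and K: "real n * (d * (v j * \<theta>\<^sup>2)) \<le> K"
    and \<sigma>: "2 \<le> \<sigma>" and est: "est \<in> estimators n"
  shows "ennreal (\<theta>\<^sup>2 * \<tau> * real j powr (- (2 * s)) / (2 * (1 + exp K)))
    \<le> max_risk M Z W \<sigma> (sobolev_ellipsoid p \<rho>) (sobolev_ellipsoid s \<tau>) n est"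
proof -
  define \<phi> where "\<phi> = (\<lambda>t. \<theta> * trig_basis j t)"
  define \<kappa> where "\<kappa> = sqrt (\<tau> * real j powr (- (2 * s)))"
  define h where "h = (\<lambda>t. \<kappa> * trig_basis j t)"
  have \<kappa>: "\<kappa>\<^sup>2 = \<tau> * real j powr (- (2 * s))"
    using pos by (simp add: \<kappa>_def)
  have w: "sobolev_weight j powr r = real j powr (2 * r)" for r
    using j by (simp add: sobolev_weight_eq powr_powr flip: powr_numeral)
  have \<phi>_L2: "\<phi> \<in> L2_unit" and h_L2: "h \<in> L2_unit"
    by (simp_all add: \<phi>_def h_def scaled_trig_basis_in_L2)
  have \<phi>_ell: "\<phi> \<in> sobolev_ellipsoid p \<rho>"
    unfolding \<phi>_def using j \<theta> by (intro scaled_trig_basis_in_sobolev_ellipsoid) (simp_all add: w)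
  have zero_ell: "(\<lambda>_. 0) \<in> sobolev_ellipsoid p \<rho>"
    using scaled_trig_basis_in_sobolev_ellipsoid[of j 0 p \<rho>] j pos by simp
  have h_ell: "h \<in> sobolev_ellipsoid s \<tau>"
    unfolding h_def using j
    by (intro scaled_trig_basis_in_sobolev_ellipsoid) (simp_all add: w \<kappa> mult.assoc flip: powr_add)
  have \<phi>_le: "\<bar>\<phi> z\<bar> \<le> 1" for z
  proof -
    have "(\<phi> z)\<^sup>2 \<le> 1 / 2 * 2"
      unfolding \<phi>_def power_mult_distrib
      using \<theta>(1) power_mono[OF abs_trig_basis_le[of j z], of 2] by (intro mult_mono) auto
    then show ?thesis by (simp add: abs_square_le_1)
  qed
  have T_L2: "cond_exp_op M Z W \<phi> \<in> L2_unit"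
    using T \<phi>_L2 by (simp add: link_class_def linear_L2_operator_def)
  have T_norm: "(l2_norm (cond_exp_op M Z W \<phi>))\<^sup>2 \<le> d * (v j * \<theta>\<^sup>2)"
  proof -
    have "ennreal ((l2_norm (cond_exp_op M Z W \<phi>))\<^sup>2) \<le> ennreal d * weighted_sq_norm v \<phi>"
      using T \<phi>_L2 by (simp add: link_class_def)
    also have "\<dots> = ennreal (d * (v j * \<theta>\<^sup>2))"
      using pos j v by (simp add: \<phi>_def weighted_sq_norm_scaled_trig_basis ennreal_mult)
    finally show ?thesis
      using pos v by (simp add: ennreal_le_iff)
  qed
  have "target M Z h \<phi> = (LINT t|unit_unif. h t * \<phi> t)"
    unfolding target_def Z_unif[symmetric] h_def \<phi>_def
    by (rule integral_distr[symmetric]) measurable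
  also have "\<dots> = (LINT t|unit_unif. (\<kappa> * \<theta>) * (trig_basis j t * trig_basis j t))"
    by (simp add: h_def \<phi>_def mult_ac)
  also have "\<dots> = \<kappa> * \<theta>"
    using l2_inner_trig_basis[OF j j] by (simp add: l2_inner_def)
  finally have target: "(target M Z h \<phi>)\<^sup>2 = \<theta>\<^sup>2 * \<tau> * real j powr (- (2 * s))"
    by (simp add: power_mult_distrib \<kappa>)
  have "real n * (l2_norm (cond_exp_op M Z W \<phi>))\<^sup>2 \<le> K"
    using mult_left_mono[OF T_norm, of "real n"] K by simp
  moreover have "\<phi> \<in> borel_measurable borel"
    unfolding \<phi>_def by measurable
  ultimately show ?thesis
    using max_risk_two_point[OF M Z W W_unif _ \<phi>_le \<phi>_ell zero_ell h_ell h_L2 T_L2 _ \<sigma> est]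
    unfolding target by blast
qed

lemma nat_ceiling_le_double:
  fixes x :: real
  assumes "1 \<le> x"
  shows "real (nat \<lceil>x\<rceil>) \<le> 2 * x"
  using assms by linarith

text \<open>
  The bound of \<open>max_risk_trig_basis\<close> for \<open>j = 1\<close>, \<open>\<theta>\<^sup>2 = min \<rho> (1 / 2)\<close> and \<open>K = d min \<rho> (1 / 2)\<close>.
\<close>

definition risk_constant :: "real \<Rightarrow> real \<Rightarrow> real \<Rightarrow> real" where
  "risk_constant \<rho> \<tau> d = min \<rho> (1 / 2) * \<tau> / (2 * (1 + exp (d * min \<rho> (1 / 2))))"

lemma risk_constant_pos: "0 < \<rho> \<Longrightarrow> 0 < \<tau> \<Longrightarrow> 0 < risk_constant \<rho> \<tau> d"
  by (simp add: risk_constant_def add_pos_pos)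

text \<open>
  At a frequency \<open>j\<close> where the operator damps the basis function so strongly that
  \<open>n v\<^sub>j j\<^bsup>-2p\<^esup> \<le> 1\<close>, the amplitude may be as large as the ellipsoid permits, of order \<open>j\<^bsup>-p\<^esup>\<close>. Together
  with the factor \<open>j\<^bsup>-s\<^esup>\<close> from the representer this gives a squared error of order
  \<open>j\<^bsup>-2(p+s)\<^esup>\<close>. The real number \<open>x\<close> is the ideal frequency, of which \<open>j\<close> will be an integer
  approximation.
\<close>

lemma max_risk_undetectable_frequency:
  fixes M :: "'m measure" and Z W :: "'m \<Rightarrow> real" and p s \<rho> \<tau> d x \<sigma> :: real and v :: "nat \<Rightarrow> real"
  assumes model: "prob_space M" "Z \<in> borel_measurable M" "W \<in> borel_measurable M"
      "distr M borel Z = unit_unif" "distr M borel W = unit_unif"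
    and par: "0 \<le> p" "0 \<le> s" "0 < \<rho>" "0 < \<tau>" "1 \<le> d" "2 \<le> \<sigma>"
    and T: "cond_exp_op M Z W \<in> link_class v d"
    and j: "1 \<le> j" and v: "0 \<le> v j" and nv: "real n * (v j * real j powr (- (2 * p))) \<le> 1"
    and x: "1 \<le> x" "real j \<le> 2 * x"
    and est: "est \<in> estimators n"
  shows "ennreal (risk_constant \<rho> \<tau> d * 2 powr (- (2 * (p + s))) * x powr (- (2 * (p + s))))
    \<le> max_risk M Z W \<sigma> (sobolev_ellipsoid p \<rho>) (sobolev_ellipsoid s \<tau>) n est"
proof -
  let ?m = "max_risk M Z W \<sigma> (sobolev_ellipsoid p \<rho>) (sobolev_ellipsoid s \<tau>) n est"
  define \<eta> where "\<eta> = min \<rho> (1 / 2)"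
  have \<eta>: "0 < \<eta>" "\<eta> \<le> 1 / 2" "\<eta> \<le> \<rho>" using par by (auto simp: \<eta>_def)
  define C where "C = risk_constant \<rho> \<tau> d"
  have C: "0 < C" unfolding C_def using par by (intro risk_constant_pos)
  have C_eq: "C = \<eta> * \<tau> / (2 * (1 + exp (d * \<eta>)))"
    by (simp only: C_def risk_constant_def \<eta>_def)
  have j_powr: "real j powr (- (2 * (p + s))) = real j powr (- (2 * p)) * real j powr (- (2 * s))"
    by (simp add: powr_add[symmetric] algebra_simps)
  define \<theta> where "\<theta> = sqrt (\<eta> * real j powr (- (2 * p)))"
  have \<theta>: "\<theta>\<^sup>2 = \<eta> * real j powr (- (2 * p))" using \<eta> by (simp add: \<theta>_def)
  have "real j powr (- (2 * p)) \<le> 1"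
    using powr_mono[of "- (2 * p)" 0 "real j"] j par by simp
  then have "\<theta>\<^sup>2 \<le> \<eta> * 1"
    unfolding \<theta> using \<eta> by (intro mult_left_mono) auto
  then have \<theta>_le: "\<theta>\<^sup>2 \<le> 1 / 2" using \<eta> by simp
  have \<theta>_ell: "\<theta>\<^sup>2 * real j powr (2 * p) \<le> \<rho>"
    using \<eta> j by (simp add: \<theta> mult.assoc flip: powr_add)
  have K: "real n * (d * (v j * \<theta>\<^sup>2)) \<le> d * \<eta>"
    using mult_left_mono[OF nv, of "d * \<eta>"] \<eta> par by (simp add: \<theta> mult_ac)
  have "C * 2 powr (- (2 * (p + s))) * x powr (- (2 * (p + s))) = C * (2 * x) powr (- (2 * (p + s)))"
    using x by (simp add: powr_mult)
  also have "\<dots> \<le> C * real j powr (- (2 * (p + s)))"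
    using C j x par by (intro mult_left_mono powr_mono2') auto
  also have "\<dots> = \<theta>\<^sup>2 * \<tau> * real j powr (- (2 * s)) / (2 * (1 + exp (d * \<eta>)))"
    unfolding C_eq j_powr \<theta> by simp
  also have "ennreal \<dots> \<le> ?m"
    by (rule max_risk_trig_basis[OF model par(3-5) T j v \<theta>_le \<theta>_ell K par(6) est])
  finally show ?thesis by (simp add: C_def ennreal_leI)
qed

section \<open>Rates of convergence\<close>

text \<open>
  The two terms of the maximum come from different alternatives. The parametric term is obtained at
  \<open>j = 1\<close> with the amplitude of order \<open>1 / sqrt n\<close>. For the other one, \<open>n j\<^bsup>-2(p+a)\<^esup>\<close>
  has to be at most one, and the smallest such frequency is \<open>n\<^bsup>1/(2(p+a))\<^esup>\<close>.
\<close>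

lemma polynomial_lower_bound:
  fixes M :: "'m measure" and Z W :: "'m \<Rightarrow> real" and p s \<rho> \<tau> d a \<sigma> :: real
  assumes model: "prob_space M" "Z \<in> borel_measurable M" "W \<in> borel_measurable M"
      "distr M borel Z = unit_unif" "distr M borel W = unit_unif"
    and par: "0 \<le> p" "0 \<le> s" "0 < \<rho>" "0 < \<tau>" "1 \<le> d" "2 \<le> \<sigma>" and a: "0 < a"
    and T: "cond_exp_op M Z W \<in> link_class (poly_weight a) d"
  shows "\<exists>c>0. \<forall>\<^sub>F n in sequentially. \<forall>est\<in>estimators n.
           max_risk M Z W \<sigma> (sobolev_ellipsoid p \<rho>) (sobolev_ellipsoid s \<tau>) n est
             \<ge> ennreal (c * max (real n powr (- (p + s) / (p + a))) (real n powr (-1)))"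
proof -
  define C where "C = risk_constant \<rho> \<tau> d"
  have C: "0 < C" unfolding C_def using par by (intro risk_constant_pos)
  define c where "c = C * 2 powr (- (2 * (p + s)))"
  have "(2 :: real) powr (- (2 * (p + s))) \<le> 2 powr 0"
    using par by (intro powr_mono) auto
  then have c: "0 < c" "c \<le> C"
    using C by (auto simp: c_def mult_left_le)
  have weight: "poly_weight a j = real j powr (- (2 * a))" if "1 \<le> j" for j
    using that by (auto simp: poly_weight_def)
  have bound: "ennreal (c * max (real n powr (- (p + s) / (p + a))) (real n powr (-1))) \<le>
      max_risk M Z W \<sigma> (sobolev_ellipsoid p \<rho>) (sobolev_ellipsoid s \<tau>) n est"
    if n: "1 \<le> n" and est: "est \<in> estimators n" for n est
  proof -
    let ?m = "max_risk M Z W \<sigma> (sobolev_ellipsoid p \<rho>) (sobolev_ellipsoid s \<tau>) n est"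
    have "ennreal (c * real n powr (-1)) \<le> ?m"
    proof -
      define \<eta> where "\<eta> = min \<rho> (1 / 2)"
      have \<eta>: "0 < \<eta>" "\<eta> \<le> 1 / 2" "\<eta> \<le> \<rho>" using par by (auto simp: \<eta>_def)
      have C_eq: "C = \<eta> * \<tau> / (2 * (1 + exp (d * \<eta>)))"
        by (simp only: C_def risk_constant_def \<eta>_def)
      define \<theta> where "\<theta> = sqrt (\<eta> / real n)"
      have \<theta>: "\<theta>\<^sup>2 = \<eta> / real n" using n \<eta> by (simp add: \<theta>_def)
      have "\<theta>\<^sup>2 \<le> \<eta>"
        using n \<eta> by (simp add: \<theta> divide_le_eq)
      then have \<theta>_le: "\<theta>\<^sup>2 \<le> 1 / 2" "\<theta>\<^sup>2 * real 1 powr (2 * p) \<le> \<rho>"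
        using \<eta> by auto
      have K: "real n * (d * (poly_weight a 1 * \<theta>\<^sup>2)) \<le> d * \<eta>"
        using n \<eta> by (simp add: weight \<theta>)
      have "c * real n powr (-1) \<le> C * real n powr (-1)"
        using c by (intro mult_right_mono) auto
      also have "\<dots> = \<theta>\<^sup>2 * \<tau> * real 1 powr (- (2 * s)) / (2 * (1 + exp (d * \<eta>)))"
        using n by (simp add: C_eq \<theta> powr_minus divide_inverse)
      also have "ennreal \<dots> \<le> ?m"
        by (rule max_risk_trig_basis[OF model par(3-5) T order_refl _ \<theta>_le K par(6) est])
          (simp add: weight)
      finally show ?thesis by (simp add: ennreal_leI)
    qed
    moreover have "ennreal (c * real n powr (- (p + s) / (p + a))) \<le> ?m"
    proof -
      define x where "x = real n powr (1 / (2 * (p + a)))"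
      define j where "j = nat \<lceil>x\<rceil>"
      have x: "1 \<le> x" using n par a by (simp add: x_def ge_one_powr_ge_zero)
      have x_powr: "x powr r = real n powr (r / (2 * (p + a)))" for r
        by (simp add: x_def powr_powr)
      have j: "1 \<le> j" "x \<le> real j" "real j \<le> 2 * x"
        using x nat_ceiling_le_double[OF x] by (auto simp: j_def le_nat_iff)
      have "0 < 2 * p + 2 * a" using par a by simp
      then have exponent: "- (2 * (p + a)) / (2 * (p + a)) = -1"
        by (simp add: divide_eq_eq)
      have "real j powr (- (2 * (p + a))) \<le> x powr (- (2 * (p + a)))"
        using j x par a by (intro powr_mono2') auto
      also have "\<dots> = 1 / real n"
        using n unfolding x_powr exponent by (simp add: powr_minus divide_inverse)
      finally have "real n * real j powr (- (2 * (p + a))) \<le> 1"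
        using n by (simp add: field_simps)
      moreover have "poly_weight a j * real j powr (- (2 * p)) = real j powr (- (2 * (p + a)))"
        by (simp add: weight[OF j(1)] powr_add[symmetric] algebra_simps)
      ultimately have "real n * (poly_weight a j * real j powr (- (2 * p))) \<le> 1"
        by simp
      then have "ennreal (c * x powr (- (2 * (p + s)))) \<le> ?m"
        unfolding c_def C_def
        by (intro max_risk_undetectable_frequency[OF model par T j(1) _ _ x j(3) est]) (simp_all add: weight[OF j(1)])
      also have "x powr (- (2 * (p + s))) = real n powr (- (p + s) / (p + a))"
        using nonzero_mult_divide_mult_cancel_left[of "2 :: real" "- (p + s)" "p + a", OF numeral_neq_zero]
        by (simp only: x_powr mult_minus_right)
      finally show ?thesis .
    qed
    ultimately show ?thesis by (simp add: max_def)
  qed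
  have "\<forall>\<^sub>F n in sequentially. \<forall>est\<in>estimators n.
      ennreal (c * max (real n powr (- (p + s) / (p + a))) (real n powr (-1))) \<le>
      max_risk M Z W \<sigma> (sobolev_ellipsoid p \<rho>) (sobolev_ellipsoid s \<tau>) n est"
    using eventually_ge_at_top[of 1] by eventually_elim (use bound in blast)
  with c show ?thesis by blast
qed

text \<open>
  The condition \<open>n exp (- j\<^bsup>2a\<^esup>) \<le> 1\<close> holds from \<open>j\<close> equal to \<open>(ln n)\<^bsup>1/(2a)\<^esup>\<close> on.
  Including the Sobolev factor \<open>j\<^bsup>-2p\<^esup>\<close> would allow a smaller frequency but not change its order.
\<close>

lemma exponential_lower_bound:
  fixes M :: "'m measure" and Z W :: "'m \<Rightarrow> real" and p s \<rho> \<tau> d a \<sigma> :: real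
  assumes model: "prob_space M" "Z \<in> borel_measurable M" "W \<in> borel_measurable M"
      "distr M borel Z = unit_unif" "distr M borel W = unit_unif"
    and par: "0 \<le> p" "0 \<le> s" "0 < \<rho>" "0 < \<tau>" "1 \<le> d" "2 \<le> \<sigma>" and a: "0 < a"
    and T: "cond_exp_op M Z W \<in> link_class (exp_weight a) d"
  shows "\<exists>c>0. \<forall>\<^sub>F n in sequentially. \<forall>est\<in>estimators n.
           max_risk M Z W \<sigma> (sobolev_ellipsoid p \<rho>) (sobolev_ellipsoid s \<tau>) n est
             \<ge> ennreal (c * (ln (real n)) powr (- (p + s) / a))"
proof -
  define c where "c = risk_constant \<rho> \<tau> d * 2 powr (- (2 * (p + s)))"
  have c: "0 < c" using risk_constant_pos par by (simp add: c_def)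
  have bound: "ennreal (c * ln (real n) powr (- (p + s) / a)) \<le>
      max_risk M Z W \<sigma> (sobolev_ellipsoid p \<rho>) (sobolev_ellipsoid s \<tau>) n est"
    \<comment> \<open>For \<open>n \<ge> 4\<close> the logarithm exceeds \<open>1\<close>, which makes the ceiling below at least \<open>2\<close>: the
      weight at \<open>j = 1\<close> does not follow the exponential formula.\<close>
    if n: "4 \<le> n" and est: "est \<in> estimators n" for n est
  proof -
    let ?m = "max_risk M Z W \<sigma> (sobolev_ellipsoid p \<rho>) (sobolev_ellipsoid s \<tau>) n est"
    have "exp 1 < real n"
      using exp_le n by linarith
    then have ln: "1 < ln (real n)"
      using ln_less_cancel_iff[of "exp 1" "real n"] n by simp
    define x where "x = ln (real n) powr (1 / (2 * a))"
    define j where "j = nat \<lceil>x\<rceil>"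
    have x: "1 < x" using ln a by (simp add: x_def)
    have x_powr: "x powr r = ln (real n) powr (r / (2 * a))" for r
      by (simp add: x_def powr_powr)
    have "1 < \<lceil>x\<rceil>" using x by (simp add: less_ceiling_iff)
    then have j: "2 \<le> j" "x \<le> real j" "real j \<le> 2 * x"
      using x nat_ceiling_le_double[of x] by (auto simp: j_def le_nat_iff)
    have "ln (real n) = x powr (2 * a)"
      using ln a by (simp add: x_powr)
    also have "\<dots> \<le> real j powr (2 * a)"
      using j x a by (intro powr_mono2) auto
    finally have "exp (- (real j powr (2 * a))) \<le> exp (- ln (real n))" by simp
    then have weight: "exp_weight a j \<le> 1 / real n"
      using j n by (simp add: exp_weight_def exp_minus divide_inverse)
    have "real j powr (- (2 * p)) \<le> 1"
      using powr_mono[of "- (2 * p)" 0 "real j"] j par by simp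
    with weight have "exp_weight a j * real j powr (- (2 * p)) \<le> 1 / real n * 1"
      by (intro mult_mono) auto
    then have "real n * (exp_weight a j * real j powr (- (2 * p))) \<le> 1"
      using n by (simp add: field_simps)
    then have "ennreal (c * x powr (- (2 * (p + s)))) \<le> ?m"
      unfolding c_def using j x
      by (intro max_risk_undetectable_frequency[OF model par T _ _ _ _ j(3) est]) (auto simp: exp_weight_def)
    also have "x powr (- (2 * (p + s))) = ln (real n) powr (- (p + s) / a)"
      unfolding x_powr by (intro arg_cong2[where f = "(powr)"] refl) (use a in \<open>simp add: field_simps\<close>)
    finally show ?thesis .
  qed
  have "\<forall>\<^sub>F n in sequentially. \<forall>est\<in>estimators n. ennreal (c * ln (real n) powr (- (p + s) / a)) \<le>
      max_risk M Z W \<sigma> (sobolev_ellipsoid p \<rho>) (sobolev_ellipsoid s \<tau>) n est"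
    using eventually_ge_at_top[of 4] by eventually_elim (use bound in blast)
  with c show ?thesis by blast
qed

theorem theorem4p1:
  fixes M :: "'m measure" and Z W :: "'m \<Rightarrow> real" and p s \<rho> \<tau> d a :: real
  assumes "prob_space M"
    and "Z \<in> borel_measurable M" and "W \<in> borel_measurable M"
    and "distr M borel Z = unit_unif" and "distr M borel W = unit_unif"
    and "p \<ge> 0" and "s \<ge> 0" and "\<rho> > 0" and "\<tau> > 0" and "d \<ge> 1" and "a > 0"
  shows "\<exists>\<sigma>0>0. \<forall>\<sigma>\<ge>\<sigma>0.
     (cond_exp_op M Z W \<in> link_class (poly_weight a) d \<longrightarrow>
        (\<exists>c>0. \<forall>\<^sub>F n in sequentially. \<forall>est\<in>estimators n.
           max_risk M Z W \<sigma> (sobolev_ellipsoid p \<rho>) (sobolev_ellipsoid s \<tau>) n est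
             \<ge> ennreal (c * max (real n powr (- (p + s) / (p + a))) (real n powr (-1))))) \<and>
     (cond_exp_op M Z W \<in> link_class (exp_weight a) d \<longrightarrow>
        (\<exists>c>0. \<forall>\<^sub>F n in sequentially. \<forall>est\<in>estimators n.
           max_risk M Z W \<sigma> (sobolev_ellipsoid p \<rho>) (sobolev_ellipsoid s \<tau>) n est
             \<ge> ennreal (c * (ln (real n)) powr (- (p + s) / a))))"
proof (rule exI[of _ 2], intro conjI allI impI)
  fix \<sigma> :: real assume \<sigma>: "2 \<le> \<sigma>" and T: "cond_exp_op M Z W \<in> link_class (poly_weight a) d"
  show "\<exists>c>0. \<forall>\<^sub>F n in sequentially. \<forall>est\<in>estimators n.
           max_risk M Z W \<sigma> (sobolev_ellipsoid p \<rho>) (sobolev_ellipsoid s \<tau>) n est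
             \<ge> ennreal (c * max (real n powr (- (p + s) / (p + a))) (real n powr (-1)))"
    by (rule polynomial_lower_bound[OF assms(1-10) \<sigma> assms(11) T])
next
  fix \<sigma> :: real assume \<sigma>: "2 \<le> \<sigma>" and T: "cond_exp_op M Z W \<in> link_class (exp_weight a) d"
  show "\<exists>c>0. \<forall>\<^sub>F n in sequentially. \<forall>est\<in>estimators n.
           max_risk M Z W \<sigma> (sobolev_ellipsoid p \<rho>) (sobolev_ellipsoid s \<tau>) n est
             \<ge> ennreal (c * (ln (real n)) powr (- (p + s) / a))"
    by (rule exponential_lower_bound[OF assms(1-10) \<sigma> assms(11) T])
qed simp

end
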